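(* Let $D \subset \mathbf{C}^n$ be a bounded domain. Let $z^0 \in \partial D$ have a neighbourhood $U$ such that $$U \cap D = \{ z \in U : |f^i(z)| < 1 \text{ for all } 1 \le i \le n \}$$ and $|f^i(z^0)| = 1$ for all $1 \le i \le n$, where $f^i \in \mathcal{O}(U)$ for all $1 \le i \le n$. Assume that $df^1 \wedge \cdots \wedge df^n \ne 0$ at $z^0$. If $z^0$ is an orbit accumulation point for the action of $\mathrm{Aut}(D)$ on $D$, then $D$ is biholomorphically equivalent to the unit polydisc $\Delta^n$.
   Context: $\mathrm{Aut}(D)$ is the group of holomorphic automorphisms of $D$. The boundary point $z^0$ is an orbit accumulation point if there are $p^0\in D$ and a sequence $F^k\in\mathrm{Aut}(D)$ with $F^k(p^0)\to z^0$. *)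

theory Defs
  imports "HOL-Analysis.Analysis"
begin

text \<open>
  The space \<open>complex ^ 'n\<close> carries a real normed vector space structure in the library; its
  complex scalar multiplication is \<open>(*s)\<close>. A function of several complex variables is therefore
  holomorphic on an open set if it is (real) Frechet differentiable at each of its points with a
  complex-linear derivative. As the derivative is taken in the full space (\<open>at z\<close>), the notion
  is meant for open sets only.
\<close>

definition holomorphic_fun_on :: "(complex ^ 'n \<Rightarrow> complex) \<Rightarrow> (complex ^ 'n) set \<Rightarrow> bool" where
  "holomorphic_fun_on f S \<longleftrightarrow>
     (\<forall>z\<in>S. \<exists>f'. (f has_derivative f') (at z) \<and> Vector_Spaces.linear (*s) (*) f')"

definition holomorphic_map_on ::
    "(complex ^ 'n \<Rightarrow> complex ^ 'm) \<Rightarrow> (complex ^ 'n) set \<Rightarrow> bool" where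
  "holomorphic_map_on F S \<longleftrightarrow> (\<forall>i. holomorphic_fun_on (\<lambda>z. F z $ i) S)"

definition domain_Cn :: "(complex ^ 'n) set \<Rightarrow> bool" where
  "domain_Cn D \<longleftrightarrow> open D \<and> connected D \<and> D \<noteq> {}"

definition biholomorphism ::
    "(complex ^ 'n) set \<Rightarrow> (complex ^ 'm) set \<Rightarrow> (complex ^ 'n \<Rightarrow> complex ^ 'm) \<Rightarrow> bool" where
  "biholomorphism D E F \<longleftrightarrow>
     bij_betw F D E \<and> holomorphic_map_on F D \<and> holomorphic_map_on (inv_into D F) E"

definition biholomorphic :: "(complex ^ 'n) set \<Rightarrow> (complex ^ 'm) set \<Rightarrow> bool" where
  "biholomorphic D E \<longleftrightarrow> (\<exists>F. biholomorphism D E F)"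

text \<open>
  Automorphisms are represented by total functions whose values outside \<open>D\<close> are irrelevant.
\<close>

definition Aut :: "(complex ^ 'n) set \<Rightarrow> (complex ^ 'n \<Rightarrow> complex ^ 'n) set" where
  "Aut D = {F. biholomorphism D D F}"

definition orbit_accumulation_point :: "(complex ^ 'n) set \<Rightarrow> complex ^ 'n \<Rightarrow> bool" where
  "orbit_accumulation_point D z \<longleftrightarrow>
     z \<in> frontier D \<and> (\<exists>p\<in>D. \<exists>F. (\<forall>k::nat. F k \<in> Aut D) \<and> (\<lambda>k. F k p) \<longlonglongrightarrow> z)"

definition unit_polydisc :: "(complex ^ 'n) set" where
  "unit_polydisc = {z. \<forall>i. norm (z $ i) < 1}"

text \<open>
  The wedge product of \<open>n\<close> linear forms on \<open>n\<close>-dimensional complex space as an alternating form,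
  \<open>(a\<^sup>1 \<and> \<dots> \<and> a\<^sup>n) (v\<^sub>1, \<dots>, v\<^sub>n) = det (a\<^sup>i (v\<^sub>j))\<close>. Both the forms and the argument vectors are
  labelled by the index type \<open>'n\<close>, so no ordering of \<open>'n\<close> is needed.
\<close>

definition wedge_forms :: "('n \<Rightarrow> complex ^ 'n \<Rightarrow> complex) \<Rightarrow> ('n::finite \<Rightarrow> complex ^ 'n) \<Rightarrow> complex"
  where "wedge_forms \<alpha> = (\<lambda>v. det (\<chi> i j. \<alpha> i (v j)))"

definition wedge_differentials ::
    "('n \<Rightarrow> complex ^ 'n \<Rightarrow> complex) \<Rightarrow> complex ^ 'n \<Rightarrow> ('n::finite \<Rightarrow> complex ^ 'n) \<Rightarrow> complex"
  where "wedge_differentials f z = wedge_forms (\<lambda>i. frechet_derivative (f i) (at z))"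

end

theory Submission
  imports Defs "HOL-Complex_Analysis.Great_Picard" "HOL-Complex_Analysis.Riemann_Mapping"
begin

text \<open>
  Let \<open>F = (f\<^sup>1, \<dots>, f\<^sup>n)\<close>. As the differentials are independent at \<open>z0\<close>, \<open>F\<close> maps a neighbourhood \<open>V\<close>
  of \<open>z0\<close> biholomorphically onto a neighbourhood \<open>W\<close> of the point \<open>\<zeta> = F z0\<close> of the torus, and
  \<open>V \<inter> D\<close> onto the corner \<open>W \<inter> \<Delta>\<close> of the polydisc \<open>\<Delta>\<close>. The proof transports this local picture to
  all of \<open>D\<close> by rescaling along the orbit.

  Let \<open>\<phi>\<^sub>k\<close> be automorphisms of \<open>D\<close> with \<open>\<phi>\<^sub>k p \<longlonglongrightarrow> z0\<close>. A limit of a subsequence takes the value \<open>z0\<close> at \<open>p\<close>,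
  where all \<open>n\<close> functions \<open>\<bar>f\<^sup>i\<bar>\<close> are at their maximum \<open>1\<close>; by the maximum principle the limit is
  constant (\<open>constant_if_touching_unimodular_point\<close>). Hence, along a subsequence, \<open>\<phi>\<^sub>k\<close> eventually moves
  each compact part of \<open>D\<close> into the corner \<open>V \<inter> D\<close>. Let \<open>m\<^sub>k\<close> be the coordinatewise Moebius map of \<open>\<Delta>\<close> that sends
  \<open>F (\<phi>\<^sub>k p)\<close> to the origin. Since the inverses of the \<open>m\<^sub>k\<close> tend to \<open>\<zeta>\<close> locally uniformly
  on \<open>\<Delta>\<close> (\<open>polydisc_moebius_tendsto_torus_point\<close>), the maps \<open>G\<^sub>k = m\<^sub>k \<circ> F \<circ> \<phi>\<^sub>k\<close> and their inverses \<open>H\<^sub>k\<close> are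
  defined on parts of \<open>D\<close> and of \<open>\<Delta>\<close> that exhaust these domains.

  It remains to see that the limits \<open>G\<close> and \<open>H\<close> of such a family are inverse biholomorphisms
  (\<open>biholomorphic_of_local_inverse_pairs\<close>). The identity \<open>H \<circ> G = id\<close> is immediate, and the point is that
  \<open>G\<close> maps onto \<open>\<Delta>\<close>. The maps \<open>G \<circ> H\<^sub>k\<close> have a limit that is the identity near the origin and hence,
  by the identity theorem, everywhere; by Brouwer's theorem a continuous map that is uniformly close to
  the identity on a ball attains the centre as a value, so every point of \<open>\<Delta>\<close> lies in \<open>G (D)\<close>.

  The function theory of several variables behind this (Montel's theorem, the maximum principle, the
  identity theorem, continuity of derivatives) comes from one variable by restriction to complex lines.
\<close>

section \<open>Holomorphy and complex-linear derivatives\<close>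

lemma norm_vector_smult: "norm (c *s x) = norm c * norm x" for x :: "complex ^ 'n"
  by (simp add: norm_vec_def L2_set_right_distrib norm_mult)

lemma norm_le_sum_norm_components: "norm x \<le> (\<Sum>i\<in>UNIV. norm (x $ i))"
  for x :: "'a::real_normed_vector ^ 'n"
  by (simp add: norm_vec_def L2_set_le_sum)

lemma bounded_linear_vector_smult_left: "bounded_linear (\<lambda>t. t *s b)" for b :: "complex ^ 'n"
  by (rule bounded_linear_intro[of _ "norm b"])
     (auto simp: norm_vector_smult vector_sadd_rdistrib vec_eq_iff)

lemma holomorphic_fun_on_iff:
  "holomorphic_fun_on f S \<longleftrightarrow>
     (\<forall>z\<in>S. \<exists>f'. (f has_derivative f') (at z) \<and> (\<forall>c h. f' (c *s h) = c * f' h))"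
proof -
  have "Vector_Spaces.linear (*s) (*) f' \<longleftrightarrow> (\<forall>c h. f' (c *s h) = c * f' h)"
    if "(f has_derivative f') (at z)" for f' z
  proof -
    have "f' (x + y) = f' x + f' y" for x y
      using has_derivative_linear[OF that] by (rule linear_add)
    thus ?thesis
      by (simp add: Vector_Spaces.linear_iff vec.vector_space_axioms
          vector_space_over_itself.vector_space_axioms)
  qed
  thus ?thesis unfolding holomorphic_fun_on_def by blast
qed

text \<open>
  Holomorphy of a map is defined by its components, whereas compositions and inverses need one
  derivative of the whole map. This lemma and the next one translate between the two views.
\<close>

lemma has_derivative_vec_iff:
  fixes F :: "'a::real_normed_vector \<Rightarrow> 'b::euclidean_space ^ 'm"
  shows "(F has_derivative F') (at z) \<longleftrightarrow> (\<forall>i. ((\<lambda>x. F x $ i) has_derivative (\<lambda>h. F' h $ i)) (at z))"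
proof
  assume "(F has_derivative F') (at z)"
  thus "\<forall>i. ((\<lambda>x. F x $ i) has_derivative (\<lambda>h. F' h $ i)) (at z)"
    by (auto intro: bounded_linear.has_derivative[OF bounded_linear_vec_nth])
next
  assume *: "\<forall>i. ((\<lambda>x. F x $ i) has_derivative (\<lambda>h. F' h $ i)) (at z)"
  show "(F has_derivative F') (at z)"
  proof (subst has_derivative_componentwise_within, intro ballI)
    fix b :: "'b ^ 'm" assume "b \<in> Basis"
    then obtain i u where b: "b = axis i u" by (auto simp: Basis_vec_def)
    show "((\<lambda>x. F x \<bullet> b) has_derivative (\<lambda>x. F' x \<bullet> b)) (at z)"
      using * by (auto simp: b inner_axis intro!: derivative_intros)
  qed
qed

lemma holomorphic_map_on_iff:
  "holomorphic_map_on F S \<longleftrightarrow>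
     (\<forall>z\<in>S. \<exists>F'. (F has_derivative F') (at z) \<and> (\<forall>c h. F' (c *s h) = c *s F' h))"
  (is "?L \<longleftrightarrow> ?R")
proof
  assume L: ?L
  show ?R
  proof
    fix z assume "z \<in> S"
    hence "\<forall>i. \<exists>f'. ((\<lambda>z. F z $ i) has_derivative f') (at z) \<and> (\<forall>c h. f' (c *s h) = c * f' h)"
      using L by (auto simp: holomorphic_map_on_def holomorphic_fun_on_iff)
    then obtain f' where f': "\<And>i. ((\<lambda>z. F z $ i) has_derivative f' i) (at z)"
      "\<And>i c h. f' i (c *s h) = c * f' i h" by metis
    have "(F has_derivative (\<lambda>h. \<chi> i. f' i h)) (at z)"
      using f'(1) by (simp add: has_derivative_vec_iff)
    moreover have "(\<chi> i. f' i (c *s h)) = c *s (\<chi> i. f' i h)" for c h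
      by (simp add: vec_eq_iff f'(2))
    ultimately show "\<exists>F'. (F has_derivative F') (at z) \<and> (\<forall>c h. F' (c *s h) = c *s F' h)"
      by blast
  qed
next
  assume R: ?R
  show ?L
    unfolding holomorphic_map_on_def holomorphic_fun_on_iff
  proof (intro allI ballI)
    fix i z assume "z \<in> S"
    with R obtain F' where "(F has_derivative F') (at z)" "\<forall>c h. F' (c *s h) = c *s F' h"
      by blast
    thus "\<exists>f'. ((\<lambda>z. F z $ i) has_derivative f') (at z) \<and> (\<forall>c h. f' (c *s h) = c * f' h)"
      by (intro exI[of _ "\<lambda>h. F' h $ i"]) (auto simp: has_derivative_vec_iff)
  qed
qed

lemma holomorphic_map_on_subset:
  "holomorphic_map_on F S \<Longrightarrow> T \<subseteq> S \<Longrightarrow> holomorphic_map_on F T"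
  by (auto simp: holomorphic_map_on_iff)

lemma holomorphic_map_on_compose:
  assumes "holomorphic_map_on F S" "holomorphic_map_on G T" "F ` S \<subseteq> T"
  shows "holomorphic_map_on (\<lambda>z. G (F z)) S"
  unfolding holomorphic_map_on_iff
proof
  fix z assume z: "z \<in> S"
  obtain F' where F': "(F has_derivative F') (at z)" "\<forall>c h. F' (c *s h) = c *s F' h"
    using assms(1) z unfolding holomorphic_map_on_iff by blast
  obtain G' where G': "(G has_derivative G') (at (F z))" "\<forall>c h. G' (c *s h) = c *s G' h"
    using assms(2,3) z unfolding holomorphic_map_on_iff by blast
  have "((\<lambda>z. G (F z)) has_derivative (\<lambda>h. G' (F' h))) (at z)"
    using has_derivative_compose[OF F'(1) G'(1)] .
  thus "\<exists>H'. ((\<lambda>z. G (F z)) has_derivative H') (at z) \<and> (\<forall>c h. H' (c *s h) = c *s H' h)"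
    using F'(2) G'(2) by auto
qed

lemma holomorphic_map_on_cong:
  assumes "open S" "holomorphic_map_on F S" "\<And>x. x \<in> S \<Longrightarrow> F x = G x"
  shows "holomorphic_map_on G S"
  unfolding holomorphic_map_on_iff
  using assms has_derivative_transform_within_open unfolding holomorphic_map_on_iff by metis

lemma holomorphic_map_on_isCont:
  "holomorphic_map_on F S \<Longrightarrow> a \<in> S \<Longrightarrow> isCont F a"
  unfolding holomorphic_map_on_iff using has_derivative_continuous by blast

lemma holomorphic_map_on_imp_continuous_on:
  "holomorphic_map_on F S \<Longrightarrow> continuous_on S F"
  by (blast intro: continuous_at_imp_continuous_on holomorphic_map_on_isCont)

text \<open>
  The bridge to one complex variable: every estimate and uniqueness principle below is the
  one-variable result applied on complex lines through a point.
\<close>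

lemma holomorphic_on_complex_line:
  assumes "holomorphic_fun_on f S"
  shows "(\<lambda>t. f (a + t *s b)) holomorphic_on {t. a + t *s b \<in> S}"
  unfolding holomorphic_on_def
proof
  fix t assume "t \<in> {t. a + t *s b \<in> S}"
  then obtain f' where f': "(f has_derivative f') (at (a + t *s b))" "\<And>c h. f' (c *s h) = c * f' h"
    using assms by (auto simp: holomorphic_fun_on_iff)
  have "((\<lambda>t. a + t *s b) has_derivative (\<lambda>t. t *s b)) (at t)"
    by (auto intro!: derivative_eq_intros bounded_linear_imp_has_derivative bounded_linear_vector_smult_left)
  from has_derivative_compose[OF this f'(1)]
  have "((\<lambda>t. f (a + t *s b)) has_derivative (\<lambda>t. f' (t *s b))) (at t)" .
  hence "((\<lambda>t. f (a + t *s b)) has_derivative (\<lambda>t. t * f' b)) (at t)" by (simp add: f'(2))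
  hence "((\<lambda>t. f (a + t *s b)) has_field_derivative f' b) (at t)"
    by (simp add: has_field_derivative_def mult_commute_abs)
  thus "(\<lambda>t. f (a + t *s b)) field_differentiable at t within {t. a + t *s b \<in> S}"
    using field_differentiable_at_within field_differentiable_def by blast
qed

section \<open>Cauchy estimates on complex lines\<close>

text \<open>
  Cauchy's inequality on circles of radius \<open>1/4\<close> about the points of the closed disc of radius
  \<open>1/2\<close> bounds the first two derivatives by \<open>4 M\<close> and \<open>32 M\<close>; Taylor's formula turns these
  bounds into estimates of the remainders.
\<close>

lemma unit_disc_taylor_estimates:
  assumes hol: "f holomorphic_on ball 0 1" and M: "\<And>t. t \<in> ball 0 1 \<Longrightarrow> norm (f t) \<le> M"
    and t: "norm t \<le> 1/2"
  shows "norm (f t - f 0) \<le> 4 * M * norm t"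
    and "norm (f t - f 0 - deriv f 0 * t) \<le> 32 * M * (norm t)\<^sup>2"
proof -
  have cauchy: "norm ((deriv ^^ n) f u) \<le> fact n * M / (1/4) ^ n" if "u \<in> cball 0 (1/2)" for n u
  proof (rule Cauchy_inequality)
    have sub: "cball u (1/4) \<subseteq> ball (0::complex) 1"
    proof
      fix x assume "x \<in> cball u (1/4)"
      thus "x \<in> ball 0 1" using that norm_triangle_ineq[of u "x-u"]
        by (simp add: dist_norm norm_minus_commute)
    qed
    show "f holomorphic_on ball u (1/4)" "continuous_on (cball u (1/4)) f"
      using hol sub ball_subset_cball[of u "1/4"]
      by (meson holomorphic_on_subset holomorphic_on_imp_continuous_on order_trans)+
    show "norm (f x) \<le> M" if "norm (u - x) = 1/4" for x
    proof (rule M)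
      show "x \<in> ball 0 1" using that by (intro subsetD[OF sub]) (simp add: dist_norm)
    qed
  qed auto
  have der: "((deriv ^^ n) f has_field_derivative (deriv ^^ Suc n) f u) (at u within cball 0 (1/2))"
    if "u \<in> cball 0 (1/2)" for n u
  proof -
    have "((deriv ^^ n) f has_field_derivative deriv ((deriv ^^ n) f) u) (at u)"
      using that by (intro holomorphic_derivI[OF holomorphic_higher_deriv[OF hol]]) auto
    thus ?thesis by (simp add: has_field_derivative_at_within)
  qed
  have tt: "t \<in> cball 0 (1/2)" using t by simp
  have "norm ((deriv ^^ 0) f t - (\<Sum>i\<le>0. (deriv ^^ i) f 0 * (t-0) ^ i / fact i))
      \<le> (4 * M) * norm (t - 0) ^ Suc 0 / fact 0"
    by (rule complex_Taylor[of "cball 0 (1/2)"]) (use tt der[of _ 0] cauchy[of _ 1] in \<open>auto simp: mult.commute\<close>)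
  thus "norm (f t - f 0) \<le> 4 * M * norm t" by simp
  have "norm ((deriv ^^ 0) f t - (\<Sum>i\<le>1. (deriv ^^ i) f 0 * (t-0) ^ i / fact i))
      \<le> (32 * M) * norm (t - 0) ^ Suc 1 / fact 1"
    by (rule complex_Taylor[of "cball 0 (1/2)"])
      (use tt der[of _ 0] der[of _ 1] cauchy[of _ 2] in
        \<open>auto simp: power2_eq_square numeral_2_eq_2 le_Suc_eq mult.commute\<close>)
  thus "norm (f t - f 0 - deriv f 0 * t) \<le> 32 * M * (norm t)\<^sup>2"
    by (simp add: power2_eq_square algebra_simps)
qed

text \<open>
  The unit disc is mapped into the ball by \<open>t \<mapsto> a + t u\<close>, where \<open>u\<close> is \<open>h\<close> rescaled to length \<open>R\<close>.
  The constants depend on \<open>M\<close> and \<open>R\<close> only, so both estimates hold uniformly for a bounded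
  family: the first gives equicontinuity, the second lets derivatives pass to the limit.
\<close>

lemma holomorphic_taylor_estimates:
  fixes f :: "complex ^ 'n \<Rightarrow> complex"
  assumes hol: "holomorphic_fun_on f (ball a R)" and M: "\<And>z. z \<in> ball a R \<Longrightarrow> norm (f z) \<le> M"
    and h: "norm h \<le> R / 2" and R: "R > 0"
  shows "norm (f (a + h) - f a) \<le> 4 * M / R * norm h"
    and "(f has_derivative f') (at a) \<Longrightarrow>
         norm (f (a + h) - f a - f' h) \<le> 32 * M / R\<^sup>2 * (norm h)\<^sup>2"
proof -
  have "norm (f (a + h) - f a) \<le> 4 * M / R * norm h \<and>
        ((f has_derivative f') (at a) \<longrightarrow>
         norm (f (a + h) - f a - f' h) \<le> 32 * M / R\<^sup>2 * (norm h)\<^sup>2)"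
  proof (cases "h = 0")
    case True
    thus ?thesis using linear_0[OF has_derivative_linear[of f f' "at a"]] by auto
  next
    case False
    define u where "u = complex_of_real (R / norm h) *s h"
    define t where "t = complex_of_real (norm h / R)"
    have nu: "norm u = R" using False R by (simp add: u_def norm_vector_smult norm_divide)
    have tu: "t *s u = h"
    proof -
      have "t * complex_of_real (R / norm h) = 1" using False R by (simp add: t_def)
      thus ?thesis by (simp add: u_def vector_smult_assoc)
    qed
    have nt: "norm t = norm h / R" using R by (simp add: t_def norm_divide)
    define \<phi> where "\<phi> = (\<lambda>t. f (a + t *s u))"
    have sub: "a + s *s u \<in> ball a R" if "s \<in> ball 0 1" for s
      using that R by (simp add: dist_norm norm_vector_smult nu)
    have hol\<phi>: "\<phi> holomorphic_on ball 0 1"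
      unfolding \<phi>_def using holomorphic_on_complex_line[OF hol, of a u]
      by (rule holomorphic_on_subset) (use sub in auto)
    have M\<phi>: "norm (\<phi> s) \<le> M" if "s \<in> ball 0 1" for s
      unfolding \<phi>_def using sub that M by blast
    have t2: "norm t \<le> 1/2" using h R by (simp add: nt field_simps)
    note est = unit_disc_taylor_estimates[OF hol\<phi> M\<phi> t2]
    have "norm (f (a + h) - f a - f' h) \<le> 32 * M / R\<^sup>2 * (norm h)\<^sup>2"
      if f': "(f has_derivative f') (at a)"
    proof -
      obtain g where g: "(f has_derivative g) (at a)" "\<And>c h. g (c *s h) = c * g h"
        using bspec[OF hol[unfolded holomorphic_fun_on_iff], of a] R by auto
      have "g = f'" using g(1) f' has_derivative_unique by blast
      with g have lin: "\<And>c h. f' (c *s h) = c * f' h" by simp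
      have "((\<lambda>t. a + t *s u) has_derivative (\<lambda>t. t *s u)) (at 0)"
        by (auto intro!: derivative_eq_intros bounded_linear_imp_has_derivative bounded_linear_vector_smult_left)
      from has_derivative_compose[OF this, of f f'] f'
      have "(\<phi> has_derivative (\<lambda>t. t * f' u)) (at 0)" by (simp add: \<phi>_def lin)
      hence "deriv \<phi> 0 = f' u"
        by (intro DERIV_imp_deriv) (simp add: has_field_derivative_def mult_commute_abs)
      moreover have "t * f' u = f' h" using lin[of t u] by (simp add: tu)
      ultimately show ?thesis using est(2) R
        by (simp add: \<phi>_def tu nt power_divide mult.commute[of _ t])
    qed
    with est(1) R show ?thesis by (simp add: \<phi>_def tu nt)
  qed
  thus "norm (f (a + h) - f a) \<le> 4 * M / R * norm h"
    and "(f has_derivative f') (at a) \<Longrightarrow>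
         norm (f (a + h) - f a - f' h) \<le> 32 * M / R\<^sup>2 * (norm h)\<^sup>2" by auto
qed

lemma lipschitz_estimate:
  fixes F :: "complex ^ 'n \<Rightarrow> complex ^ 'm"
  assumes hol: "holomorphic_map_on F (ball a R)" and M: "\<And>z. z \<in> ball a R \<Longrightarrow> norm (F z) \<le> M"
    and R: "R > 0" and x: "x \<in> ball a (R/8)" and y: "y \<in> ball a (R/8)"
  shows "norm (F y - F x) \<le> CARD('m) * (8 * M / R) * norm (y - x)"
proof -
  \<comment> \<open>The Taylor estimate on the ball of radius \<open>R / 2\<close> about \<open>x\<close> reaches the points within \<open>R / 4\<close>.\<close>
  have dxy: "dist x y < R / 4" using x y dist_triangle2[of x y a] by (simp add: dist_commute)
  have sub: "ball x (R/2) \<subseteq> ball a R"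
  proof
    fix z assume "z \<in> ball x (R/2)"
    thus "z \<in> ball a R" using x R dist_triangle[of a z x] by simp
  qed
  have "norm (F y $ i - F x $ i) \<le> 8 * M / R * norm (y - x)" for i
  proof -
    have "norm (F (x + (y - x)) $ i - F x $ i) \<le> 4 * M / (R/2) * norm (y - x)"
    proof (rule holomorphic_taylor_estimates(1)[where f = "\<lambda>z. F z $ i"])
      show "holomorphic_fun_on (\<lambda>z. F z $ i) (ball x (R/2))"
        using holomorphic_map_on_subset[OF hol sub] by (simp add: holomorphic_map_on_def)
      show "norm (F z $ i) \<le> M" if "z \<in> ball x (R/2)" for z
        using order_trans[OF Finite_Cartesian_Product.norm_nth_le M[OF subsetD[OF sub that]]] .
    qed (use dxy R in \<open>auto simp: dist_norm norm_minus_commute\<close>)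
    thus ?thesis by simp
  qed
  hence "(\<Sum>i\<in>UNIV. norm ((F y - F x) $ i)) \<le> (\<Sum>i\<in>(UNIV::'m set). 8 * M / R * norm (y - x))"
    by (intro sum_mono) simp
  moreover have "norm (F y - F x) \<le> (\<Sum>i\<in>UNIV. norm ((F y - F x) $ i))"
    by (rule norm_le_sum_norm_components)
  ultimately show ?thesis by simp
qed

section \<open>Limits of bounded sequences of holomorphic maps\<close>

text \<open>
  The derivatives of the \<open>g k\<close> at \<open>a\<close> are bounded by the Taylor estimates, hence converge to some
  complex-linear \<open>L\<close> along a subsequence. The quadratic remainder estimate survives the limit and
  says that \<open>L\<close> is the derivative of the limit function.
\<close>

lemma holomorphic_pointwise_limit_at:
  fixes g :: "nat \<Rightarrow> complex ^ 'n \<Rightarrow> complex"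
  assumes hol: "\<And>k. holomorphic_fun_on (g k) (ball a R)"
    and M: "\<And>k z. z \<in> ball a R \<Longrightarrow> norm (g k z) \<le> M"
    and lim: "\<And>z. z \<in> ball a R \<Longrightarrow> (\<lambda>k. g k z) \<longlonglongrightarrow> l z" and R: "R > 0"
  shows "holomorphic_fun_on l {a}"
proof -
  have aR: "a \<in> ball a R" using R by simp
  have M0: "M \<ge> 0" using M[OF aR] norm_ge_zero order_trans by blast
  obtain g' where g': "\<And>k. (g k has_derivative g' k) (at a)" "\<And>k c h. g' k (c *s h) = c * g' k h"
  proof -
    have "\<forall>k. \<exists>g'. (g k has_derivative g') (at a) \<and> (\<forall>c h. g' (c *s h) = c * g' h)"
      using hol aR unfolding holomorphic_fun_on_iff by blast
    from choice[OF this] show ?thesis using that by blast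
  qed
  have lin: "linear (g' k)" for k using g'(1) has_derivative_linear by blast
  define c :: "nat \<Rightarrow> complex ^ 'n" where "c k = (\<chi> j. g' k (axis j 1))" for k
  have rep: "g' k h = (\<Sum>j\<in>UNIV. h $ j * c k $ j)" for k h
  proof -
    have "g' k h = g' k (\<Sum>j\<in>UNIV. h $ j *s axis j 1)"
      by (simp add: basis_expansion)
    thus ?thesis by (simp add: linear_sum[OF lin] g'(2) c_def)
  qed
  have est: "norm (g k (a + h) - g k a - g' k h) \<le> 32 * M / R\<^sup>2 * (norm h)\<^sup>2" if "norm h \<le> R / 2" for k h
    using holomorphic_taylor_estimates(2)[OF hol M that R g'(1)] .
  have "norm (c k $ j) \<le> (2 / R) * (2 * M + 8 * M)" for k j
  proof -
    \<comment> \<open>The longest multiple of the basis vector for which the Taylor estimate is available.\<close>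
    define h where "h = complex_of_real (R/2) *s (axis j 1 :: complex ^ 'n)"
    have nh: "norm h = R / 2" using R by (simp add: h_def norm_vector_smult)
    have ahR: "a + h \<in> ball a R" using nh R by (simp add: dist_norm)
    have "norm (g' k h) \<le> norm (g k (a + h)) + norm (g k a) + norm (g k (a + h) - g k a - g' k h)"
      using order_trans[OF norm_triangle_ineq4 add_right_mono[OF norm_triangle_ineq4],
          of "g k (a + h)" "g k a" "g k (a + h) - g k a - g' k h"] by simp
    also have "\<dots> \<le> M + M + 32 * M / R\<^sup>2 * (norm h)\<^sup>2"
      using M[OF ahR] M[OF aR] est[of h k] nh by (intro add_mono) auto
    also have "\<dots> = 2 * M + 8 * M" using R by (simp add: nh power_divide)
    finally have "norm (g' k h) \<le> 2 * M + 8 * M" .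
    moreover have "norm (g' k h) = R / 2 * norm (c k $ j)"
      using R by (simp add: h_def g'(2) c_def norm_mult norm_divide)
    ultimately show ?thesis using R by (simp add: field_simps)
  qed
  hence "norm (c k) \<le> (\<Sum>j\<in>(UNIV::'n set). (2 / R) * (2 * M + 8 * M))" for k
    by (intro order_trans[OF norm_le_sum_norm_components] sum_mono) auto
  hence "bounded (range c)" by (auto simp: bounded_iff)
  then obtain C r where r: "strict_mono r" "(c \<circ> r) \<longlonglongrightarrow> C"
    using bounded_imp_convergent_subsequence by blast
  define L where "L h = (\<Sum>j\<in>UNIV. h $ j * C $ j)" for h :: "complex ^ 'n"
  have limL: "(\<lambda>k. g' (r k) h) \<longlonglongrightarrow> L h" for h
    unfolding rep L_def using tendsto_vec_nth[OF r(2)] by (intro tendsto_sum tendsto_mult tendsto_const) (simp add: o_def)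
  have estL: "norm (l (a + h) - l a - L h) \<le> 32 * M / R\<^sup>2 * (norm h)\<^sup>2" if h: "norm h \<le> R / 2" for h
  proof (rule LIMSEQ_le_const2)
    have "a + h \<in> ball a R" using h R by (simp add: dist_norm)
    from LIMSEQ_subseq_LIMSEQ[OF lim[OF this] r(1)] LIMSEQ_subseq_LIMSEQ[OF lim[OF aR] r(1)]
    show "(\<lambda>k. norm (g (r k) (a + h) - g (r k) a - g' (r k) h)) \<longlonglongrightarrow> norm (l (a + h) - l a - L h)"
      by (intro tendsto_intros limL) (auto simp: o_def)
    show "\<exists>N. \<forall>k\<ge>N. norm (g (r k) (a + h) - g (r k) a - g' (r k) h) \<le> 32 * M / R\<^sup>2 * (norm h)\<^sup>2"
      using est[OF h] by blast
  qed
  have "bounded_linear L"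
    unfolding L_def by (intro bounded_linear_sum bounded_linear_mult_const[OF bounded_linear_vec_nth])
  moreover have "\<exists>d>0. \<forall>y. norm (y - a) < d \<longrightarrow> norm (l y - l a - L (y - a)) \<le> e * norm (y - a)"
    if e: "e > 0" for e
  proof (intro exI conjI allI impI)
    define K where "K = 32 * M / R\<^sup>2"
    have K: "K \<ge> 0" using M0 by (simp add: K_def)
    show "min (R/2) (e / (K + 1)) > 0" using e R K by simp
    fix y assume y: "norm (y - a) < min (R/2) (e / (K + 1))"
    have "norm (l (a + (y - a)) - l a - L (y - a)) \<le> K * (norm (y - a))\<^sup>2"
      unfolding K_def by (rule estL) (use y in auto)
    also have "\<dots> = (K * norm (y - a)) * norm (y - a)" by (simp add: power2_eq_square)
    also have "\<dots> \<le> e * norm (y - a)"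
    proof (rule mult_right_mono)
      have "K * norm (y - a) \<le> (K + 1) * norm (y - a)" by (simp add: distrib_right)
      also have "\<dots> \<le> e" using y K by (simp add: pos_less_divide_eq mult.commute)
      finally show "K * norm (y - a) \<le> e" .
    qed simp
    finally show "norm (l y - l a - L (y - a)) \<le> e * norm (y - a)" by simp
  qed
  ultimately have "(l has_derivative L) (at a)" by (auto simp: has_derivative_at_alt)
  moreover have "L (s *s h) = s * L h" for s h by (simp add: L_def sum_distrib_left mult.assoc)
  ultimately show ?thesis by (auto simp: holomorphic_fun_on_iff)
qed

text \<open>
  Near a given point of \<open>X\<close> the hypothesis speaks of large \<open>k\<close> only, so that the theorem covers maps
  whose domains of definition exhaust \<open>X\<close> as \<open>k\<close> grows. A subsequence
  converges on a countable dense set; the uniform Lipschitz bound extends the convergence to small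
  balls, where it is uniform.
\<close>

lemma Montel_several_variables:
  fixes g :: "nat \<Rightarrow> complex ^ 'n \<Rightarrow> complex ^ 'm"
  assumes g: "\<And>a. a \<in> X \<Longrightarrow> \<exists>r>0. \<forall>\<^sub>F k in sequentially.
      holomorphic_map_on (g k) (ball a r) \<and> (\<forall>x\<in>ball a r. norm (g k x) \<le> M)"
  obtains s l where "strict_mono (s :: nat \<Rightarrow> nat)" "holomorphic_map_on l X"
    "\<And>a. a \<in> X \<Longrightarrow> \<exists>r>0. uniform_limit (ball a r) (\<lambda>k. g (s k)) l sequentially"
proof -
  obtain Q :: "(complex ^ 'n) set" where Q: "countable Q" "\<And>T. open T \<Longrightarrow> T \<noteq> {} \<Longrightarrow> \<exists>d\<in>Q. d \<in> T"
    using countable_dense_exists by metis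
  \<comment> \<open>Far out in the sequence \<open>g0\<close> agrees with \<open>g\<close> at each point of \<open>X\<close>; the cut-off supplies the
    bound for all indices that the diagonal argument asks for.\<close>
  define g0 where "g0 k x = (if norm (g k x) \<le> M then g k x else 0)" for k x
  have "norm (g0 k x) \<le> \<bar>M\<bar>" for k x by (auto simp: g0_def)
  then obtain s where s: "strict_mono s" "\<And>x. x \<in> Q \<Longrightarrow> \<exists>l. (\<lambda>k. g0 (s k) x) \<longlonglongrightarrow> l"
    using function_convergent_subsequence[OF Q(1), of g0 "\<bar>M\<bar>"] by blast
  define l where "l x = lim (\<lambda>k. g (s k) x)" for x
  have key: "\<exists>r>0. uniform_limit (ball a r) (\<lambda>k. g (s k)) l sequentially \<and>
      (\<forall>\<^sub>F k in sequentially. holomorphic_map_on (g (s k)) (ball a r) \<and> (\<forall>x\<in>ball a r. norm (g (s k) x) \<le> M))"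
    if a: "a \<in> X" for a
  proof -
    obtain r where r: "r > 0" and ev0: "\<forall>\<^sub>F k in sequentially.
      holomorphic_map_on (g k) (ball a r) \<and> (\<forall>x\<in>ball a r. norm (g k x) \<le> M)"
      using g[OF a] by blast
    have ev: "\<forall>\<^sub>F k in sequentially.
      holomorphic_map_on (g (s k)) (ball a r) \<and> (\<forall>x\<in>ball a r. norm (g (s k) x) \<le> M)"
      using eventually_subseq[OF s(1) ev0] .
    obtain N where N: "\<And>k. k \<ge> N \<Longrightarrow> holomorphic_map_on (g (s k)) (ball a r)"
      "\<And>k x. k \<ge> N \<Longrightarrow> x \<in> ball a r \<Longrightarrow> norm (g (s k) x) \<le> M"
      using ev unfolding eventually_sequentially by blast
    define K where "K = real CARD('m) * (8 * M / r)"
    have "M \<ge> 0" using order_trans[OF norm_ge_zero N(2)[of N a]] r by simp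
    hence K: "K \<ge> 0" using r by (simp add: K_def)
    have lip: "norm (g (s k) y - g (s k) x) \<le> K * norm (y - x)"
      if "k \<ge> N" "x \<in> ball a (r/8)" "y \<in> ball a (r/8)" for k x y
      unfolding K_def by (rule lipschitz_estimate) (use that N r in auto)
    have "uniformly_Cauchy_on (ball a (r/16)) (\<lambda>k. g (s k))"
    proof (rule uniformly_Cauchy_onI)
      fix e :: real assume e: "e > 0"
      define d where "d = e / 4 / (K + 1)"
      have d: "d > 0" using e K by (simp add: d_def)
      have Kd: "K * d \<le> e / 4"
      proof -
        have "K * d \<le> (K + 1) * d" using d by simp
        also have "\<dots> = e / 4"
          using nonzero_divide_eq_eq[of "K + 1" "e / 4" d] K by (simp add: d_def mult.commute)
        finally show ?thesis .
      qed
      \<comment> \<open>Finitely many dense points come within \<open>d\<close> of every point of the ball, and moving by \<open>d\<close>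
        changes each member of the sequence by at most \<open>e / 4\<close>.\<close>
      have cover: "cball a (r/16) \<subseteq> (\<Union>q\<in>Q \<inter> ball a (r/8). ball q d)"
      proof
        fix x assume "x \<in> cball a (r/16)"
        hence "x \<in> ball x d \<inter> ball a (r/8)" using d r by auto
        then obtain q where "q \<in> Q" "q \<in> ball x d \<inter> ball a (r/8)"
          using Q(2)[of "ball x d \<inter> ball a (r/8)"] by blast
        thus "x \<in> (\<Union>q\<in>Q \<inter> ball a (r/8). ball q d)" by (auto simp: dist_commute)
      qed
      obtain T where T: "T \<subseteq> Q \<inter> ball a (r/8)" "finite T" "cball a (r/16) \<subseteq> (\<Union>q\<in>T. ball q d)"
      proof (rule compactE_image[OF compact_cball _ cover])
        show "open (ball q d)" for q by simp
      qed (rule that)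
      have "\<exists>N'. \<forall>m\<ge>N'. \<forall>n\<ge>N'. norm (g (s m) q - g (s n) q) < e / 4" if qT: "q \<in> T" for q
      proof -
        obtain L where "(\<lambda>k. g0 (s k) q) \<longlonglongrightarrow> L" using s(2) T(1) qT by blast
        moreover have "\<forall>\<^sub>F k in sequentially. g0 (s k) q = g (s k) q"
          using eventually_ge_at_top[of N] by eventually_elim (use N(2) T(1) qT r in \<open>fastforce simp: g0_def\<close>)
        ultimately have "(\<lambda>k. g (s k) q) \<longlonglongrightarrow> L" using tendsto_cong by fast
        hence "Cauchy (\<lambda>k. g (s k) q)" by (rule LIMSEQ_imp_Cauchy)
        moreover have "e / 4 > 0" using e by simp
        ultimately show ?thesis unfolding Cauchy_def dist_norm by blast
      qed
      then obtain n where n: "\<And>q m k. q \<in> T \<Longrightarrow> m \<ge> n q \<Longrightarrow> k \<ge> n q \<Longrightarrow> norm (g (s m) q - g (s k) q) < e / 4"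
        by metis
      define N' where "N' = Max (insert N (n ` T))"
      show "\<exists>N'. \<forall>x\<in>ball a (r/16). \<forall>m\<ge>N'. \<forall>k\<ge>N'. dist (g (s m) x) (g (s k) x) < e"
      proof (intro exI ballI allI impI)
        fix x m k assume x: "x \<in> ball a (r/16)" and mk: "m \<ge> N'" "k \<ge> N'"
        obtain q where q: "q \<in> T" "x \<in> ball q d" using x T(3) by force
        have "n q \<le> N'" "N \<le> N'" using T(2) q(1) by (auto simp: N'_def)
        hence mk': "m \<ge> N" "k \<ge> N" "m \<ge> n q" "k \<ge> n q" using mk by auto
        have xq: "x \<in> ball a (r/8)" "q \<in> ball a (r/8)" using x q T(1) r by auto
        have nxq: "norm (x - q) \<le> d" using q(2) by (simp add: dist_norm norm_minus_commute)
        have L: "norm (g (s j) x - g (s j) q) \<le> e / 4" if "j \<ge> N" for j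
        proof -
          have "norm (g (s j) x - g (s j) q) \<le> K * norm (x - q)" using lip[OF that xq(2) xq(1)] .
          also have "\<dots> \<le> K * d" using nxq K by (rule mult_left_mono)
          finally show ?thesis using Kd by simp
        qed
        have "dist (g (s m) x) (g (s k) x) \<le>
          norm (g (s m) x - g (s m) q) + norm (g (s m) q - g (s k) q) + norm (g (s k) x - g (s k) q)"
          using dist_triangle[of "g (s m) x" "g (s k) x" "g (s m) q"]
            dist_triangle[of "g (s m) q" "g (s k) x" "g (s k) q"] dist_commute[of "g (s k) q" "g (s k) x"]
          unfolding dist_norm by linarith
        also have "\<dots> < e" using L[OF mk'(1)] L[OF mk'(2)] n[OF q(1) mk'(3,4)] e by linarith
        finally show "dist (g (s m) x) (g (s k) x) < e" .
      qed
    qed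
    hence "uniform_limit (ball a (r/16)) (\<lambda>k. g (s k)) l sequentially"
      unfolding l_def uniformly_convergent_uniform_limit_iff[symmetric] by (rule Cauchy_uniformly_convergent)
    moreover have "\<forall>\<^sub>F k in sequentially. holomorphic_map_on (g (s k)) (ball a (r/16)) \<and>
        (\<forall>x\<in>ball a (r/16). norm (g (s k) x) \<le> M)"
      using ev by eventually_elim (use r in \<open>auto elim!: holomorphic_map_on_subset\<close>)
    ultimately show ?thesis using r by (intro exI[of _ "r/16"]) auto
  qed
  have "holomorphic_map_on l X"
    unfolding holomorphic_map_on_def
  proof
    fix i
    have "holomorphic_fun_on (\<lambda>z. l z $ i) {a}" if a: "a \<in> X" for a
    proof -
      obtain r where r: "r > 0" and lim: "uniform_limit (ball a r) (\<lambda>k. g (s k)) l sequentially"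
        and ev: "\<forall>\<^sub>F k in sequentially. holomorphic_map_on (g (s k)) (ball a r) \<and> (\<forall>x\<in>ball a r. norm (g (s k) x) \<le> M)"
        using key[OF a] by blast
      obtain N where N: "\<And>k. k \<ge> N \<Longrightarrow> holomorphic_map_on (g (s k)) (ball a r)"
        "\<And>k x. k \<ge> N \<Longrightarrow> x \<in> ball a r \<Longrightarrow> norm (g (s k) x) \<le> M"
        using ev unfolding eventually_sequentially by blast
      show ?thesis
      proof (rule holomorphic_pointwise_limit_at)
        show "holomorphic_fun_on (\<lambda>z. g (s (k + N)) z $ i) (ball a r)" for k
          using N(1)[of "k + N"] by (simp add: holomorphic_map_on_def)
        show "norm (g (s (k + N)) z $ i) \<le> M" if "z \<in> ball a r" for k z
          using N(2)[of "k + N" z] that order_trans[OF Finite_Cartesian_Product.norm_nth_le]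
          by simp
        show "(\<lambda>k. g (s (k + N)) z $ i) \<longlonglongrightarrow> l z $ i" if "z \<in> ball a r" for z
          using LIMSEQ_ignore_initial_segment[OF tendsto_uniform_limitI[OF lim that], of N]
          by (rule tendsto_vec_nth)
      qed (rule r)
    qed
    thus "holomorphic_fun_on (\<lambda>z. l z $ i) X" by (auto simp: holomorphic_fun_on_def)
  qed
  moreover have "\<exists>r>0. uniform_limit (ball a r) (\<lambda>k. g (s k)) l sequentially" if "a \<in> X" for a
    using key[OF that] by blast
  ultimately show thesis by (rule that[OF s(1)])
qed

lemma uniform_limit_subseq:
  "uniform_limit X f l sequentially \<Longrightarrow> strict_mono s \<Longrightarrow> uniform_limit X (\<lambda>k. f (s k)) l sequentially"
  unfolding uniform_limit_iff using eventually_subseq by blast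

lemma tendsto_uniform_limit_moving_point:
  fixes g :: "nat \<Rightarrow> 'a::metric_space \<Rightarrow> 'b::metric_space"
  assumes lim: "uniform_limit (ball a r) g l sequentially" and r: "r > 0"
    and cont: "continuous (at a) l" and x: "x \<longlonglongrightarrow> a"
  shows "(\<lambda>k. g k (x k)) \<longlonglongrightarrow> l a"
proof (rule tendstoI)
  fix e :: real assume "e > 0"
  hence e: "e / 2 > 0" by simp
  have "(\<lambda>k. l (x k)) \<longlonglongrightarrow> l a" using isCont_tendsto_compose[OF cont x] .
  from tendstoD[OF this e] uniform_limitD[OF lim e] tendstoD[OF x r]
  show "\<forall>\<^sub>F k in sequentially. dist (g k (x k)) (l a) < e"
  proof eventually_elim
    case (elim k)
    hence "dist (g k (x k)) (l (x k)) < e / 2" by (auto simp: dist_commute)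
    thus ?case using elim(1) dist_triangle[of "g k (x k)" "l a" "l (x k)"] by linarith
  qed
qed

section \<open>The maximum principle and the identity theorem\<close>

text \<open>
  Restricted to the complex line through \<open>a\<close> and \<open>z\<close>, the function attains its maximum modulus at
  an interior point.
\<close>

lemma maximum_modulus_ball:
  fixes f :: "complex ^ 'n \<Rightarrow> complex"
  assumes hol: "holomorphic_fun_on f (ball a r)" and max: "\<And>z. z \<in> ball a r \<Longrightarrow> norm (f z) \<le> norm (f a)"
    and z: "z \<in> ball a r"
  shows "f z = f a"
proof (cases "z = a")
  case False
  define R where "R = r / norm (z - a)"
  have n: "norm (z - a) > 0" using False by simp
  have R: "R > 1" using z n by (simp add: R_def dist_norm norm_minus_commute)
  have sub: "a + t *s (z - a) \<in> ball a r" if "t \<in> ball 0 R" for t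
  proof -
    have "dist a (a + t *s (z - a)) = norm t * norm (z - a)"
      unfolding norm_vector_smult[symmetric] by (simp add: dist_norm del: vector_ssub_ldistrib)
    thus ?thesis using that n by (simp add: R_def pos_less_divide_eq)
  qed
  have "(\<lambda>t. f (a + t *s (z - a))) constant_on ball 0 R"
  proof (rule maximum_modulus_principle)
    show "(\<lambda>t. f (a + t *s (z - a))) holomorphic_on ball 0 R"
      by (rule holomorphic_on_subset[OF holomorphic_on_complex_line[OF hol]]) (use sub in auto)
    show "0 \<in> ball (0::complex) R" using R by simp
    show "norm (f (a + t *s (z - a))) \<le> norm (f (a + 0 *s (z - a)))" if "t \<in> ball 0 R" for t
      using max[OF sub[OF that]] by simp
  qed auto
  then obtain c where c: "\<And>t. t \<in> ball 0 R \<Longrightarrow> f (a + t *s (z - a)) = c" by (auto simp: constant_on_def)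
  show ?thesis using c[of 0] c[of 1] R by simp
qed simp

text \<open>
  The complex line through \<open>a\<close> and \<open>w\<close> meets the convex set \<open>E\<close> in a convex, hence connected, set
  of parameters, so the one-variable identity theorem reaches \<open>w\<close> from a neighbourhood of \<open>a\<close>.
\<close>

lemma holomorphic_identity_convex:
  fixes f g :: "complex ^ 'n \<Rightarrow> complex"
  assumes hol: "holomorphic_fun_on f E" "holomorphic_fun_on g E" and E: "open E" "convex E" and a: "a \<in> E"
    and eq: "\<forall>\<^sub>F z in nhds a. f z = g z" and w: "w \<in> E"
  shows "f w = g w"
proof -
  let ?line = "\<lambda>t. a + t *s (w - a)"
  define T where "T = {t. ?line t \<in> E}"
  have cont: "continuous_on UNIV ?line"
    by (intro continuous_intros linear_continuous_on bounded_linear_vector_smult_left)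
  obtain V where V: "open V" "a \<in> V" "\<And>z. z \<in> V \<Longrightarrow> f z = g z"
    using eq unfolding eventually_nhds by blast
  have "f (?line 1) = g (?line 1)"
  proof (rule analytic_continuation_open[where f = "\<lambda>t. f (?line t)" and g = "\<lambda>t. g (?line t)"
        and s = "?line -` (E \<inter> V)" and s' = T])
    show "open (?line -` (E \<inter> V))" by (rule open_vimage[OF open_Int[OF E(1) V(1)] cont])
    show "open T" unfolding T_def using open_vimage[OF E(1) cont] by (simp add: vimage_def)
    have "0 \<in> ?line -` (E \<inter> V)" using a V by simp
    thus "?line -` (E \<inter> V) \<noteq> {}" by blast
    have "convex T"
    proof (rule convexI)
      fix x y :: complex and u v :: real assume xy: "x \<in> T" "y \<in> T" and uv: "u \<ge> 0" "v \<ge> 0" "u + v = 1"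
      have v: "v = 1 - u" using uv by simp
      have "u *\<^sub>R ?line x + v *\<^sub>R ?line y \<in> E"
        using xy uv E(2) by (auto simp: T_def convex_def)
      moreover have "u *\<^sub>R ?line x + v *\<^sub>R ?line y = ?line (u *\<^sub>R x + v *\<^sub>R y)"
        unfolding v vec_eq_iff by (simp add: algebra_simps)
      ultimately show "u *\<^sub>R x + v *\<^sub>R y \<in> T" by (simp add: T_def)
    qed
    thus "connected T" by (rule convex_connected)
    show "?line -` (E \<inter> V) \<subseteq> T" by (auto simp: T_def)
    show "(\<lambda>t. f (?line t)) holomorphic_on T" "(\<lambda>t. g (?line t)) holomorphic_on T"
      unfolding T_def by (intro holomorphic_on_complex_line hol)+
    show "1 \<in> T" using w by (simp add: T_def)
  qed (use V in auto)
  thus ?thesis by simp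
qed

lemma connected_level_set_propagates:
  fixes \<Phi> :: "'a::metric_space \<Rightarrow> 'b::t1_space"
  assumes "connected D" "continuous_on D \<Phi>" "p \<in> D" "\<Phi> p = c"
    and local: "\<And>a. a \<in> D \<Longrightarrow> \<Phi> a = c \<Longrightarrow> \<exists>r>0. ball a r \<subseteq> D \<and> (\<forall>x\<in>ball a r. \<Phi> x = c)"
    and x: "x \<in> D"
  shows "\<Phi> x = c"
proof -
  let ?S = "{x \<in> D. \<Phi> x = c}"
  have "open ?S"
    unfolding open_contains_ball using local by blast
  hence "openin (top_of_set D) ?S" by (auto intro: open_subset)
  moreover have "closedin (top_of_set D) ?S"
    by (rule continuous_closedin_preimage_constant[OF assms(2)])
  ultimately have "?S = {} \<or> ?S = D" using \<open>connected D\<close> unfolding connected_clopen by blast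
  thus ?thesis using assms(3,4) x by blast
qed

lemma maximum_modulus_connected:
  fixes f :: "complex ^ 'n \<Rightarrow> complex"
  assumes D: "open D" "connected D" and hol: "holomorphic_fun_on f D" and a: "a \<in> D"
    and max: "\<And>z. z \<in> D \<Longrightarrow> norm (f z) \<le> norm (f a)" and z: "z \<in> D"
  shows "f z = f a"
proof (rule connected_level_set_propagates[OF D(2) _ a refl _ z])
  show "continuous_on D f"
    using hol unfolding holomorphic_fun_on_def
    by (meson continuous_at_imp_continuous_on has_derivative_continuous)
  fix b assume b: "b \<in> D" "f b = f a"
  obtain r where r: "r > 0" "ball b r \<subseteq> D" using D(1) b(1) by (meson openE)
  have "holomorphic_fun_on f (ball b r)" using hol r(2) by (auto simp: holomorphic_fun_on_def)
  hence "\<forall>x\<in>ball b r. f x = f a"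
    using maximum_modulus_ball[of f b r] max b(2) r(2) by (metis subsetD)
  thus "\<exists>r>0. ball b r \<subseteq> D \<and> (\<forall>x\<in>ball b r. f x = f a)" using r by blast
qed

text \<open>
  Where \<open>\<Phi>\<close> takes the value \<open>z0\<close>, every component of \<open>F \<circ> \<Phi>\<close> attains its maximum modulus \<open>1\<close> and
  is therefore locally constant; as \<open>F\<close> is injective, \<open>\<Phi>\<close> is locally constant too, and the level
  set of \<open>z0\<close> is open as well as closed. Applied to a limit of automorphisms, this shows that one
  orbit accumulating at \<open>z0\<close> drags all of \<open>D\<close> to \<open>z0\<close>.
\<close>

lemma constant_if_touching_unimodular_point:
  fixes \<Phi> :: "complex ^ 'n \<Rightarrow> complex ^ 'm" and F :: "complex ^ 'm \<Rightarrow> complex ^ 'l"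
  assumes D: "open D" "connected D" and \<Phi>: "holomorphic_map_on \<Phi> D" and p: "p \<in> D" "\<Phi> p = z0"
    and V: "open V" "z0 \<in> V" and F: "holomorphic_map_on F V" "inj_on F V"
    and one: "\<And>i. norm (F z0 $ i) = 1"
    and le: "\<And>x i. x \<in> D \<Longrightarrow> \<Phi> x \<in> V \<Longrightarrow> norm (F (\<Phi> x) $ i) \<le> 1"
    and x: "x \<in> D"
  shows "\<Phi> x = z0"
proof (rule connected_level_set_propagates[OF D(2) holomorphic_map_on_imp_continuous_on[OF \<Phi>] p _ x])
  fix a assume a: "a \<in> D" "\<Phi> a = z0"
  have "open (D \<inter> \<Phi> -` V)"
    using continuous_open_preimage[OF holomorphic_map_on_imp_continuous_on[OF \<Phi>] D(1) V(1)] .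
  then obtain r where r: "r > 0" "ball a r \<subseteq> D \<inter> \<Phi> -` V"
    using a V(2) by (metis Int_iff openE vimage_eq)
  have hol: "holomorphic_map_on (\<lambda>x. F (\<Phi> x)) (ball a r)"
    by (rule holomorphic_map_on_compose[OF holomorphic_map_on_subset[OF \<Phi>] F(1)]) (use r(2) in auto)
  have "\<Phi> y = z0" if y: "y \<in> ball a r" for y
  proof -
    have "F (\<Phi> y) $ i = F (\<Phi> a) $ i" for i
    proof (rule maximum_modulus_ball[OF _ _ y])
      show "holomorphic_fun_on (\<lambda>x. F (\<Phi> x) $ i) (ball a r)"
        using hol by (simp add: holomorphic_map_on_def)
      show "norm (F (\<Phi> z) $ i) \<le> norm (F (\<Phi> a) $ i)" if "z \<in> ball a r" for z
      proof -
        have "z \<in> D" "\<Phi> z \<in> V" using that r(2) by auto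
        thus ?thesis using le one a(2) by simp
      qed
    qed
    hence "F (\<Phi> y) = F z0" using a(2) by (simp add: vec_eq_iff)
    thus ?thesis using inj_onD[OF F(2)] y r(2) V(2) by blast
  qed
  with r show "\<exists>r>0. ball a r \<subseteq> D \<and> (\<forall>x\<in>ball a r. \<Phi> x = z0)" by blast
qed

section \<open>The inverse function theorem\<close>

text \<open>
  The increment \<open>f (y + k) - f x\<close> is expanded in two ways: in one step from \<open>x\<close>, and in two steps,
  from \<open>x\<close> to \<open>y\<close> and from \<open>y\<close> to \<open>y + k\<close>. If \<open>k\<close> is parallel to \<open>h\<close> and as long as \<open>y - x\<close>, all three
  remainders are quadratic in \<open>norm (y - x)\<close>, which makes the derivative locally Lipschitz.
\<close>

lemma holomorphic_derivative_continuous: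
  fixes f :: "complex ^ 'n \<Rightarrow> complex"
  assumes U: "open U" and hol: "holomorphic_fun_on f U"
    and f': "\<And>z. z \<in> U \<Longrightarrow> (f has_derivative f' z) (at z)"
  shows "continuous_on U (\<lambda>z. f' z h)"
proof (cases "h = 0")
  case True
  have "f' z h = 0" if "z \<in> U" for z
    using linear_0[OF has_derivative_linear[OF f'[OF that]]] True by simp
  thus ?thesis by (simp cong: continuous_on_cong)
next
  case False
  have "isCont (\<lambda>z. f' z h) x" if x: "x \<in> U" for x
  proof -
    define M where "M = norm (f x) + 1"
    have "isCont f x" using f'[OF x] by (rule has_derivative_continuous)
    hence "(f \<longlongrightarrow> f x) (nhds x)" unfolding isCont_def by (simp only: tendsto_at_iff_tendsto_nhds)
    from tendstoD[OF this zero_less_one] have "\<forall>\<^sub>F y in nhds x. norm (f y) \<le> M"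
    proof eventually_elim
      case (elim y)
      thus ?case using norm_triangle_ineq2[of "f y" "f x"] by (simp add: M_def dist_norm)
    qed
    with eventually_nhds_in_open[OF U x] have "\<forall>\<^sub>F y in nhds x. y \<in> U \<and> norm (f y) \<le> M"
      by eventually_elim auto
    then obtain R where R: "R > 0" "\<And>y. y \<in> ball x R \<Longrightarrow> y \<in> U" "\<And>y. y \<in> ball x R \<Longrightarrow> norm (f y) \<le> M"
      unfolding eventually_nhds_metric by (auto simp: dist_commute)
    define K where "K = 32 * M / (R/2)\<^sup>2"
    have est: "norm (f (y + k) - f y - f' y k) \<le> K * (norm k)\<^sup>2"
      if y: "y \<in> ball x (R/8)" and k: "norm k \<le> R / 4" for y k
      unfolding K_def
    proof (rule holomorphic_taylor_estimates(2)[of f y "R/2"])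
      have sub: "z \<in> ball x R" if "z \<in> ball y (R/2)" for z
        using y that dist_triangle[of x z y] R(1) by (simp add: dist_commute)
      show "holomorphic_fun_on f (ball y (R/2))"
        using hol sub R(2) unfolding holomorphic_fun_on_def by blast
      show "norm (f z) \<le> M" if "z \<in> ball y (R/2)" for z using R(3) sub that by blast
      show "(f has_derivative f' y) (at y)" using f' R(2) y R(1) by simp
    qed (use k R(1) in auto)
    have lip: "norm (f' y h - f' x h) \<le> (6 * K * norm h) * norm (y - x)" if y: "y \<in> ball x (R/8)" for y
    proof (cases "y = x")
      case False
      define d where "d = norm (y - x)"
      have d: "d > 0" "d < R / 8" using False y by (auto simp: d_def dist_norm norm_minus_commute)
      define k where "k = (d / norm h) *\<^sub>R h"
      have nk: "norm k = d" using \<open>h \<noteq> 0\<close> d by (simp add: k_def)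
      have xx: "x \<in> ball x (R/8)" and yU: "y \<in> U" "x \<in> U" using R y by auto
      have lx: "linear (f' x)" and ly: "linear (f' y)" using f' yU has_derivative_linear by blast+
      have nyk: "norm (y - x + k) \<le> 2 * d" using norm_triangle_ineq[of "y - x" k] nk by (simp add: d_def)
      have "K \<ge> 0" using norm_ge_zero[of "f x"] by (simp add: K_def M_def)
      have A: "norm (f (y + k) - f y - f' y k) \<le> K * d\<^sup>2"
        using est[OF y, of k] nk d by simp
      have "norm (f (x + (y - x + k)) - f x - f' x (y - x + k)) \<le> K * (norm (y - x + k))\<^sup>2"
        by (rule est[OF xx]) (use nyk d in auto)
      also have "\<dots> \<le> K * (2 * d)\<^sup>2" using nyk \<open>K \<ge> 0\<close> by (intro mult_left_mono power_mono) auto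
      finally have B: "norm (f (y + k) - f x - f' x (y - x) - f' x k) \<le> 4 * (K * d\<^sup>2)"
        unfolding linear_add[OF lx] by (simp add: diff_diff_eq add.assoc power2_eq_square mult.left_commute)
      have C: "norm (f y - f x - f' x (y - x)) \<le> K * d\<^sup>2"
        using est[OF xx, of "y - x"] d R(1) by (simp add: d_def)
      have "f' y k - f' x k = (f (y + k) - f x - f' x (y - x) - f' x k)
          - (f (y + k) - f y - f' y k) - (f y - f x - f' x (y - x))" by simp
      also have "norm \<dots> \<le> 4 * (K * d\<^sup>2) + K * d\<^sup>2 + K * d\<^sup>2"
        by (rule order_trans[OF norm_triangle_ineq4
              add_mono[OF order_trans[OF norm_triangle_ineq4 add_mono[OF B A]] C]])
      finally have "norm (f' y k - f' x k) \<le> 6 * K * d\<^sup>2" by simp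
      moreover have "f' y k - f' x k = (d / norm h) *\<^sub>R (f' y h - f' x h)"
        by (simp add: k_def linear_scale[OF lx] linear_scale[OF ly] scaleR_diff_right)
      ultimately have "(d / norm h) * norm (f' y h - f' x h) \<le> 6 * K * d\<^sup>2" using d by simp
      thus ?thesis using d \<open>h \<noteq> 0\<close> by (simp add: field_simps power2_eq_square d_def)
    qed simp
    have "((\<lambda>y. f' y h - f' x h) \<longlongrightarrow> 0) (at x)"
    proof (rule Lim_null_comparison)
      have "\<forall>\<^sub>F y in at x. y \<in> ball x (R/8)" using R(1) by (intro eventually_at_in_open') auto
      thus "\<forall>\<^sub>F y in at x. norm (f' y h - f' x h) \<le> (6 * K * norm h) * norm (y - x)"
        by eventually_elim (rule lip)
      have "((\<lambda>y. (6 * K * norm h) * norm (y - x)) \<longlongrightarrow> (6 * K * norm h) * norm (x - x)) (at x)"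
        by (intro tendsto_intros)
      thus "((\<lambda>y. (6 * K * norm h) * norm (y - x)) \<longlongrightarrow> 0) (at x)" by simp
    qed
    thus ?thesis unfolding isCont_def by (simp add: LIM_zero_iff)
  qed
  thus ?thesis by (intro continuous_at_imp_continuous_on ballI)
qed

text \<open>
  The real inverse function theorem applies because holomorphic maps are continuously
  differentiable. The derivative of the inverse is the inverse of a complex-linear map, hence
  complex-linear.
\<close>

lemma holomorphic_inverse_function_theorem:
  fixes F :: "complex ^ 'n \<Rightarrow> complex ^ 'n"
  assumes U: "open U" and hol: "holomorphic_map_on F U" and z0: "z0 \<in> U"
    and F0: "(F has_derivative F0) (at z0)" "inj F0"
  obtains V W g where "open V" "V \<subseteq> U" "z0 \<in> V" "open W" "F z0 \<in> W" "homeomorphism V W F g"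
    "holomorphic_map_on g W"
proof -
  define F' where "F' z = Blinfun (frechet_derivative F (at z))" for z
  have fd: "(F has_derivative frechet_derivative F (at z)) (at z)"
    and fl: "frechet_derivative F (at z) (c *s h) = c *s frechet_derivative F (at z) h" if z: "z \<in> U" for z c h
  proof -
    obtain T where T: "(F has_derivative T) (at z)" "\<And>c h. T (c *s h) = c *s T h"
      using hol z unfolding holomorphic_map_on_iff by blast
    have "frechet_derivative F (at z) = T" using frechet_derivative_at[OF T(1)] by simp
    thus "(F has_derivative frechet_derivative F (at z)) (at z)"
      "frechet_derivative F (at z) (c *s h) = c *s frechet_derivative F (at z) h" using T by auto
  qed
  have app: "blinfun_apply (F' z) = frechet_derivative F (at z)" if "z \<in> U" for z
    unfolding F'_def by (rule bounded_linear_Blinfun_apply[OF has_derivative_bounded_linear[OF fd[OF that]]])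
  have der: "(F has_derivative blinfun_apply (F' z)) (at z)" if "z \<in> U" for z
    using fd[OF that] app[OF that] by simp
  have F0eq: "blinfun_apply (F' z0) = F0" using der[OF z0] F0(1) has_derivative_unique by blast
  have cont: "continuous_on U F'"
  proof (rule continuous_on_blinfun_componentwise)
    fix h :: "complex ^ 'n"
    have "continuous_on U (\<lambda>z. blinfun_apply (F' z) h $ i)" for i
    proof (rule holomorphic_derivative_continuous[OF U])
      show "holomorphic_fun_on (\<lambda>z. F z $ i) U" using hol by (simp add: holomorphic_map_on_def)
      show "((\<lambda>z. F z $ i) has_derivative (\<lambda>h. blinfun_apply (F' z) h $ i)) (at z)" if "z \<in> U" for z
        using der[OF that] by (simp add: has_derivative_vec_iff)
    qed
    thus "continuous_on U (\<lambda>z. blinfun_apply (F' z) h)"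
      unfolding continuous_on_def by (auto intro: vec_tendstoI)
  qed
  obtain T where T: "linear T" "T \<circ> F0 = id"
    using linear_injective_left_inverse[OF has_derivative_linear[OF F0(1)] F0(2)] by blast
  have "Blinfun T o\<^sub>L F' z0 = id_blinfun"
    by (rule blinfun_eqI)
      (use T in \<open>simp add: bounded_linear_Blinfun_apply linear_conv_bounded_linear F0eq fun_eq_iff\<close>)
  then obtain V W g g' where *: "open V" "V \<subseteq> U" "z0 \<in> V" "open W" "F z0 \<in> W" "homeomorphism V W F g"
    and g': "\<And>y. y \<in> W \<Longrightarrow> (g has_derivative (g' y)) (at y)"
      "\<And>y. y \<in> W \<Longrightarrow> g' y = inv (blinfun_apply (F' (g y)))"
      "\<And>y. y \<in> W \<Longrightarrow> bij (blinfun_apply (F' (g y)))"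
    using inverse_function_theorem[OF U der cont z0] by metis
  have "g' y (c *s h) = c *s g' y h" if y: "y \<in> W" for y c h
  proof -
    have "g y \<in> U" using *(2,6) y by (auto simp: homeomorphism_def)
    let ?A = "blinfun_apply (F' (g y))"
    have "?A (c *s inv ?A h) = c *s h"
      using fl[OF \<open>g y \<in> U\<close>, of c "inv ?A h"] g'(3)[OF y] app[OF \<open>g y \<in> U\<close>]
      by (simp add: bij_is_surj surj_f_inv_f)
    thus ?thesis using g'(2,3)[OF y] by (metis bij_inv_eq_iff)
  qed
  hence "holomorphic_map_on g W" using g'(1) unfolding holomorphic_map_on_iff by blast
  with * show thesis by (rule that)
qed

text \<open>
  A nonzero determinant \<open>det (L (v\<^sub>j)\<^sub>i)\<close> makes the vectors \<open>L (v\<^sub>j)\<close> span, so \<open>L\<close> is onto, hence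
  injective as an endomorphism of a finite-dimensional space.
\<close>

lemma inj_of_wedge_forms_nonzero:
  fixes L :: "complex ^ 'n \<Rightarrow> complex ^ 'n"
  assumes L: "linear L" "\<And>c h. L (c *s h) = c *s L h"
    and wedge: "wedge_forms (\<lambda>i h. L h $ i) \<noteq> (\<lambda>v. 0)"
  shows "inj L"
proof -
  obtain v where "det (\<chi> i j. L (v j) $ i) \<noteq> 0"
    using wedge by (auto simp: wedge_forms_def fun_eq_iff)
  define A where "A = (\<chi> i j. L (v j) $ i)"
  have "invertible A" using \<open>det (\<chi> i j. L (v j) $ i) \<noteq> 0\<close> by (simp add: invertible_det_nz A_def)
  then obtain B where B: "A ** B = mat 1" by (auto simp: invertible_def)
  have "y \<in> range L" for y
  proof -
    define x where "x = B *v y"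
    have "L (\<Sum>j\<in>UNIV. x $ j *s v j) = A *v x"
      unfolding linear_sum[OF L(1)] L(2)
      by (simp add: vec_eq_iff matrix_vector_mult_def A_def mult.commute)
    also have "\<dots> = y" by (simp add: x_def matrix_vector_mul_assoc B)
    finally show ?thesis by (metis rangeI)
  qed
  hence "surj L" by blast
  thus ?thesis using linear_surjective_imp_injective[OF L(1)] by blast
qed

section \<open>The polydisc\<close>

lemma convex_unit_polydisc: "convex (unit_polydisc :: (complex ^ 'n) set)"
proof (rule convexI)
  fix x y :: "complex ^ 'n" and u v :: real
  assume "x \<in> unit_polydisc" "y \<in> unit_polydisc" "0 \<le> u" "0 \<le> v" "u + v = 1"
  hence "u *\<^sub>R x $ i + v *\<^sub>R y $ i \<in> ball 0 1" for i
    by (intro convexD[OF convex_ball]) (auto simp: unit_polydisc_def)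
  thus "u *\<^sub>R x + v *\<^sub>R y \<in> unit_polydisc" by (simp add: unit_polydisc_def)
qed

lemma open_unit_polydisc: "open (unit_polydisc :: (complex ^ 'n) set)"
proof -
  have eq: "unit_polydisc = (\<Inter>i. {z :: complex ^ 'n. norm (z $ i) < 1})" by (auto simp: unit_polydisc_def)
  show ?thesis
    unfolding eq by (intro open_INT ballI open_Collect_less continuous_intros) simp
qed

lemma bounded_unit_polydisc: "bounded (unit_polydisc :: (complex ^ 'n) set)"
  unfolding bounded_iff
proof (intro exI ballI)
  fix z :: "complex ^ 'n" assume "z \<in> unit_polydisc"
  hence "(\<Sum>i\<in>UNIV. norm (z $ i)) \<le> (\<Sum>i\<in>(UNIV :: 'n set). 1)"
    by (intro sum_mono) (auto simp: unit_polydisc_def less_imp_le)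
  thus "norm z \<le> (\<Sum>i\<in>(UNIV :: 'n set). 1)" using norm_le_sum_norm_components order_trans by blast
qed

lemma norm_le_1_of_mem_closure_unit_polydisc:
  fixes z :: "complex ^ 'n"
  assumes "z \<in> closure unit_polydisc"
  shows "norm (z $ i) \<le> 1"
proof -
  have "closed {z :: complex ^ 'n. norm (z $ i) \<le> 1}"
    by (intro closed_Collect_le continuous_intros)
  hence "closure unit_polydisc \<subseteq> {z :: complex ^ 'n. norm (z $ i) \<le> 1}"
    by (intro closure_minimal) (auto simp: unit_polydisc_def less_imp_le)
  thus ?thesis using assms by blast
qed

text \<open>
  A component of modulus \<open>1\<close> at one point would be constant on \<open>D\<close>, also at \<open>p\<close>.
\<close>

lemma unit_polydisc_taut:
  fixes l :: "complex ^ 'n \<Rightarrow> complex ^ 'm"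
  assumes D: "open D" "connected D" and l: "holomorphic_map_on l D" "l ` D \<subseteq> closure unit_polydisc"
    and p: "p \<in> D" "l p \<in> unit_polydisc"
  shows "l ` D \<subseteq> unit_polydisc"
proof -
  have "norm (l x $ i) < 1" if x: "x \<in> D" for x i
  proof (rule ccontr)
    have le: "norm (l y $ i) \<le> 1" if "y \<in> D" for y
      using norm_le_1_of_mem_closure_unit_polydisc l(2) that by blast
    assume "\<not> norm (l x $ i) < 1"
    hence one: "norm (l x $ i) = 1" using le[OF x] by simp
    have "l p $ i = l x $ i"
      by (rule maximum_modulus_connected[OF D _ x _ p(1), of "\<lambda>x. l x $ i"])
         (use l(1) le one in \<open>auto simp: holomorphic_map_on_def\<close>)
    moreover have "norm (l p $ i) < 1" using p(2) by (simp add: unit_polydisc_def)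
    ultimately show False using one by simp
  qed
  thus ?thesis by (auto simp: unit_polydisc_def)
qed

text \<open>
  The automorphism of the polydisc that interchanges \<open>q\<close> with the origin up to sign; its inverse
  is the one with parameter \<open>- q\<close>.
\<close>

definition polydisc_moebius :: "complex ^ 'n \<Rightarrow> complex ^ 'n \<Rightarrow> complex ^ 'n" where
  "polydisc_moebius q z = (\<chi> i. Moebius_function 0 (q $ i) (z $ i))"

lemma polydisc_moebius_self: "polydisc_moebius q q = 0"
  by (simp add: polydisc_moebius_def vec_eq_iff Moebius_function_eq_zero)

lemma polydisc_moebius_mem:
  "q \<in> unit_polydisc \<Longrightarrow> z \<in> unit_polydisc \<Longrightarrow> polydisc_moebius q z \<in> unit_polydisc"
  by (simp add: unit_polydisc_def polydisc_moebius_def Moebius_function_norm_lt_1)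

lemma uminus_mem_unit_polydisc: "- q \<in> unit_polydisc \<longleftrightarrow> q \<in> unit_polydisc"
  by (simp add: unit_polydisc_def)

lemma polydisc_moebius_inverse:
  assumes "q \<in> unit_polydisc" "z \<in> unit_polydisc"
  shows "polydisc_moebius q (polydisc_moebius (- q) z) = z"
    and "polydisc_moebius (- q) (polydisc_moebius q z) = z"
  using assms by (simp_all add: polydisc_moebius_def unit_polydisc_def vec_eq_iff Moebius_function_compose)

lemma holomorphic_polydisc_moebius:
  fixes q :: "complex ^ 'n"
  assumes q: "q \<in> unit_polydisc"
  shows "holomorphic_map_on (polydisc_moebius q) unit_polydisc"
  unfolding holomorphic_map_on_def holomorphic_fun_on_iff
proof (intro allI ballI)
  fix i and z :: "complex ^ 'n" assume z: "z \<in> unit_polydisc"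
  let ?m = "Moebius_function 0 (q $ i)"
  have "(?m has_field_derivative deriv ?m (z $ i)) (at (z $ i))"
    using q z Moebius_function_holomorphic by (intro holomorphic_derivI[of _ "ball 0 1"]) (auto simp: unit_polydisc_def)
  hence "(?m has_derivative (*) (deriv ?m (z $ i))) (at (z $ i))" by (simp add: has_field_derivative_def)
  moreover have "((\<lambda>z. z $ i) has_derivative (\<lambda>h. h $ i)) (at z)"
    by (rule bounded_linear_imp_has_derivative[OF bounded_linear_vec_nth])
  ultimately have "((\<lambda>z. ?m (z $ i)) has_derivative (\<lambda>h. deriv ?m (z $ i) * h $ i)) (at z)"
    using has_derivative_compose by blast
  hence "((\<lambda>z. polydisc_moebius q z $ i) has_derivative (\<lambda>h. deriv ?m (z $ i) * h $ i)) (at z)"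
    by (simp add: polydisc_moebius_def)
  thus "\<exists>f'. ((\<lambda>z. polydisc_moebius q z $ i) has_derivative f') (at z) \<and> (\<forall>c h. f' (c *s h) = c * f' h)"
    by (intro exI[of _ "\<lambda>h. deriv ?m (z $ i) * h $ i"]) simp
qed

text \<open>
  As \<open>q\<close> tends to a point \<open>\<zeta>\<close> of the torus, the automorphism \<open>y \<mapsto> (y + q) / (1 + cnj q y)\<close> of the
  polydisc degenerates to the constant \<open>\<zeta>\<close>. Letting both arguments vary shows that it maps a whole
  neighbourhood of \<open>b\<close> close to \<open>\<zeta>\<close>.
\<close>

lemma polydisc_moebius_tendsto_torus_point:
  assumes one: "\<And>i. norm (\<zeta> $ i) = 1" and b: "b \<in> unit_polydisc"
  shows "((\<lambda>(q, y). polydisc_moebius (- q) y) \<longlongrightarrow> \<zeta>) (nhds \<zeta> \<times>\<^sub>F nhds b)"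
proof (rule vec_tendstoI)
  fix i
  have nb: "norm (cnj (\<zeta> $ i) * b $ i) < 1"
    using b one[of i] by (simp add: norm_mult unit_polydisc_def)
  have nz: "1 + cnj (\<zeta> $ i) * b $ i \<noteq> 0"
  proof
    assume "1 + cnj (\<zeta> $ i) * b $ i = 0"
    hence "cnj (\<zeta> $ i) * b $ i = - 1" by (simp add: add_eq_0_iff)
    thus False using nb by simp
  qed
  have tq: "((\<lambda>x. fst x $ i) \<longlongrightarrow> \<zeta> $ i) (nhds \<zeta> \<times>\<^sub>F nhds b)"
    by (rule tendsto_vec_nth) (rule filterlim_fst)
  have ty: "((\<lambda>x. snd x $ i) \<longlongrightarrow> b $ i) (nhds \<zeta> \<times>\<^sub>F nhds b)"
    by (rule tendsto_vec_nth) (rule filterlim_snd)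
  have "((\<lambda>x. (snd x $ i + fst x $ i) / (1 + cnj (fst x $ i) * snd x $ i)) \<longlongrightarrow>
      (b $ i + \<zeta> $ i) / (1 + cnj (\<zeta> $ i) * b $ i)) (nhds \<zeta> \<times>\<^sub>F nhds b)"
    by (intro tendsto_intros tq ty nz)
  also have "(b $ i + \<zeta> $ i) / (1 + cnj (\<zeta> $ i) * b $ i) = \<zeta> $ i"
  proof -
    have "\<zeta> $ i * cnj (\<zeta> $ i) = 1" using one[of i] by (simp add: complex_norm_square[symmetric])
    hence "\<zeta> $ i * (1 + cnj (\<zeta> $ i) * b $ i) = b $ i + \<zeta> $ i" by (simp add: distrib_left mult.assoc[symmetric])
    thus ?thesis using nz by (simp add: divide_eq_eq)
  qed
  finally show "((\<lambda>x. (case x of (q, y) \<Rightarrow> polydisc_moebius (- q) y) $ i) \<longlongrightarrow> \<zeta> $ i) (nhds \<zeta> \<times>\<^sub>F nhds b)"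
    by (simp add: case_prod_beta polydisc_moebius_def Moebius_function_simple)
qed

section \<open>Limits of locally defined mutually inverse maps\<close>

text \<open>
  Brouwer's theorem: a fixed point of \<open>x \<mapsto> x - e x + w\<close> is a preimage of \<open>w\<close>.
\<close>

lemma mem_image_if_uniformly_near_identity:
  fixes e :: "'a::euclidean_space \<Rightarrow> 'a"
  assumes "r > 0" and cont: "continuous_on (cball w r) e"
    and near: "\<And>x. x \<in> cball w r \<Longrightarrow> dist (e x) x \<le> r"
  shows "w \<in> e ` cball w r"
proof -
  obtain x where x: "x \<in> cball w r" "x - e x + w = x"
  proof (rule brouwer_ball)
    show "continuous_on (cball w r) (\<lambda>x. x - e x + w)" by (intro continuous_intros cont)
    show "(\<lambda>x. x - e x + w) \<in> cball w r \<rightarrow> cball w r"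
      using near by (auto simp: dist_norm)
  qed (use \<open>r > 0\<close> in auto)
  hence "e x = w" by (simp add: algebra_simps)
  thus ?thesis using x(1) by blast
qed

text \<open>
  Pass to limits \<open>Gl\<close> and \<open>Hl\<close> of the \<open>G k\<close> and \<open>H k\<close>. By tautness \<open>Gl\<close> maps \<open>D\<close> into \<open>E\<close>, and
  \<open>Hl \<circ> Gl\<close> is the identity of \<open>D\<close>. The opposite identity is clear only at the points that \<open>Hl\<close>
  maps into \<open>D\<close>, and a limit of maps into \<open>D\<close> may reach the frontier of \<open>D\<close>. The way around is to
  look at \<open>Gl \<circ> H k\<close>, defined near each point of \<open>E\<close> for large \<open>k\<close>: these maps accumulate at a map that
  is the identity near \<open>w0\<close>, hence on \<open>E\<close>. So some \<open>Gl \<circ> H k\<close> is uniformly close to the identity on a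
  closed ball about a given point of \<open>E\<close>, and its image, which lies in \<open>Gl ` D\<close>, contains the point.
\<close>

lemma biholomorphic_of_local_inverse_pairs:
  fixes D :: "(complex ^ 'n) set" and E :: "(complex ^ 'm) set"
  assumes D: "open D" "bounded D" and E: "open E" "convex E" "bounded E"
    and GE: "\<And>a. a \<in> D \<Longrightarrow> \<exists>r>0. \<forall>\<^sub>F k in sequentially. holomorphic_map_on (G k) (ball a r) \<and>
        (\<forall>x\<in>ball a r. G k x \<in> E \<and> H k (G k x) = x)"
    and HD: "\<And>b. b \<in> E \<Longrightarrow> \<exists>r>0. \<forall>\<^sub>F k in sequentially. holomorphic_map_on (H k) (ball b r) \<and>
        (\<forall>y\<in>ball b r. H k y \<in> D \<and> G k (H k y) = y)"
    and p: "p \<in> D" and w0: "w0 \<in> E" and base: "\<And>k. G k p = w0"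
    and taut: "\<And>l. holomorphic_map_on l D \<Longrightarrow> l ` D \<subseteq> closure E \<Longrightarrow> l p \<in> E \<Longrightarrow> l ` D \<subseteq> E"
  shows "biholomorphic D E"
proof -
  obtain MD where MD: "\<And>x. x \<in> D \<Longrightarrow> norm x \<le> MD" using D(2) by (auto simp: bounded_iff)
  obtain ME where ME: "\<And>x. x \<in> E \<Longrightarrow> norm x \<le> ME" using E(3) by (auto simp: bounded_iff)
  obtain s1 Gl where s1: "strict_mono s1" and Gl: "holomorphic_map_on Gl D"
    and limG1: "\<And>a. a \<in> D \<Longrightarrow> \<exists>r>0. uniform_limit (ball a r) (\<lambda>k. G (s1 k)) Gl sequentially"
  proof (rule Montel_several_variables[of D G ME])
    fix a assume "a \<in> D"
    then obtain r where "r > 0" and ev: "\<forall>\<^sub>F k in sequentially. holomorphic_map_on (G k) (ball a r) \<and>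
        (\<forall>x\<in>ball a r. G k x \<in> E \<and> H k (G k x) = x)" using GE by blast
    moreover from ev have "\<forall>\<^sub>F k in sequentially. holomorphic_map_on (G k) (ball a r) \<and>
        (\<forall>x\<in>ball a r. norm (G k x) \<le> ME)" by eventually_elim (use ME in blast)
    ultimately show "\<exists>r>0. \<forall>\<^sub>F k in sequentially. holomorphic_map_on (G k) (ball a r) \<and>
        (\<forall>x\<in>ball a r. norm (G k x) \<le> ME)" by blast
  qed (rule that)
  obtain s2 Hl where s2: "strict_mono s2" and Hl: "holomorphic_map_on Hl E"
    and limH: "\<And>b. b \<in> E \<Longrightarrow> \<exists>r>0. uniform_limit (ball b r) (\<lambda>k. H (s1 (s2 k))) Hl sequentially"
  proof (rule Montel_several_variables[of E "\<lambda>k. H (s1 k)" MD])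
    fix b assume "b \<in> E"
    then obtain r where "r > 0" and ev: "\<forall>\<^sub>F k in sequentially. holomorphic_map_on (H k) (ball b r) \<and>
        (\<forall>y\<in>ball b r. H k y \<in> D \<and> G k (H k y) = y)" using HD by blast
    moreover from eventually_subseq[OF s1 ev]
    have "\<forall>\<^sub>F k in sequentially. holomorphic_map_on (H (s1 k)) (ball b r) \<and>
        (\<forall>x\<in>ball b r. norm (H (s1 k) x) \<le> MD)" by eventually_elim (use MD in blast)
    ultimately show "\<exists>r>0. \<forall>\<^sub>F k in sequentially. holomorphic_map_on (H (s1 k)) (ball b r) \<and>
        (\<forall>x\<in>ball b r. norm (H (s1 k) x) \<le> MD)" by blast
  qed (rule that)
  define s where "s k = s1 (s2 k)" for k
  have s: "strict_mono s" unfolding s_def using s1 s2 by (auto simp: strict_mono_def)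
  have movG: "(\<lambda>k. G (s k) (x k)) \<longlonglongrightarrow> Gl a" if "a \<in> D" "x \<longlonglongrightarrow> a" for a x
  proof -
    obtain r where "r > 0" "uniform_limit (ball a r) (\<lambda>k. G (s1 k)) Gl sequentially"
      using limG1 \<open>a \<in> D\<close> by blast
    thus ?thesis
      using tendsto_uniform_limit_moving_point[OF uniform_limit_subseq[OF _ s2]]
        holomorphic_map_on_isCont[OF Gl] that unfolding s_def by blast
  qed
  have movH: "(\<lambda>k. H (s k) (y k)) \<longlonglongrightarrow> Hl b" if "b \<in> E" "y \<longlonglongrightarrow> b" for b y
  proof -
    obtain r where "r > 0" "uniform_limit (ball b r) (\<lambda>k. H (s1 (s2 k))) Hl sequentially"
      using limH \<open>b \<in> E\<close> by blast
    thus ?thesis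
      using tendsto_uniform_limit_moving_point holomorphic_map_on_isCont[OF Hl] that
      unfolding s_def by blast
  qed
  have evG: "\<forall>\<^sub>F k in sequentially. G (s k) x \<in> E \<and> H (s k) (G (s k) x) = x" if x: "x \<in> D" for x
  proof -
    obtain r where "r > 0" "\<forall>\<^sub>F k in sequentially. holomorphic_map_on (G k) (ball x r) \<and>
        (\<forall>x\<in>ball x r. G k x \<in> E \<and> H k (G k x) = x)" using GE[OF x] by blast
    from this(1) eventually_subseq[OF s this(2)] show ?thesis by (auto elim: eventually_mono)
  qed
  have evH: "\<forall>\<^sub>F k in sequentially. H (s k) y \<in> D \<and> G (s k) (H (s k) y) = y" if y: "y \<in> E" for y
  proof -
    obtain r where "r > 0" "\<forall>\<^sub>F k in sequentially. holomorphic_map_on (H k) (ball y r) \<and>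
        (\<forall>y\<in>ball y r. H k y \<in> D \<and> G k (H k y) = y)" using HD[OF y] by blast
    from this(1) eventually_subseq[OF s this(2)] show ?thesis by (auto elim: eventually_mono)
  qed

  have Glp: "Gl p = w0" using LIMSEQ_unique[OF movG[OF p tendsto_const]] base by simp
  have GlE: "Gl x \<in> E" if "x \<in> D" for x
  proof -
    have "Gl x \<in> closure E" if "x \<in> D" for x
      by (rule Lim_in_closed_set[OF closed_closure _ sequentially_bot movG[OF that tendsto_const]])
         (use evG[OF that] closure_subset in \<open>auto elim!: eventually_mono\<close>)
    hence "Gl ` D \<subseteq> E" using taut[OF Gl] Glp w0 by blast
    thus ?thesis using that by blast
  qed
  have HG: "Hl (Gl x) = x" if "x \<in> D" for x
  proof (rule LIMSEQ_unique)
    show "(\<lambda>k. H (s k) (G (s k) x)) \<longlonglongrightarrow> Hl (Gl x)"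
      by (rule movH[OF GlE[OF that] movG[OF that tendsto_const]])
    show "(\<lambda>k. H (s k) (G (s k) x)) \<longlonglongrightarrow> x"
      by (rule tendsto_eventually) (use evG[OF that] in \<open>auto elim: eventually_mono\<close>)
  qed
  have GH: "Gl (Hl y) = y" if "y \<in> E" "Hl y \<in> D" for y
  proof (rule LIMSEQ_unique)
    show "(\<lambda>k. G (s k) (H (s k) y)) \<longlonglongrightarrow> Gl (Hl y)"
      by (rule movG[OF that(2) movH[OF that(1) tendsto_const]])
    show "(\<lambda>k. G (s k) (H (s k) y)) \<longlonglongrightarrow> y"
      by (rule tendsto_eventually) (use evH[OF that(1)] in \<open>auto elim: eventually_mono\<close>)
  qed

  \<comment> \<open>The auxiliary maps \<open>Gl \<circ> H (s k)\<close> from parts of \<open>E\<close> into \<open>E\<close> form a normal family.\<close>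
  have evE: "\<exists>r>0. \<forall>\<^sub>F k in sequentially. holomorphic_map_on (\<lambda>y. Gl (H (s k) y)) (ball b r) \<and>
        (\<forall>y\<in>ball b r. H (s k) y \<in> D \<and> norm (Gl (H (s k) y)) \<le> ME)" if b: "b \<in> E" for b
  proof -
    obtain r where "r > 0" and ev: "\<forall>\<^sub>F k in sequentially. holomorphic_map_on (H k) (ball b r) \<and>
        (\<forall>y\<in>ball b r. H k y \<in> D \<and> G k (H k y) = y)" using HD[OF b] by blast
    moreover from eventually_subseq[OF s ev]
    have "\<forall>\<^sub>F k in sequentially. holomorphic_map_on (\<lambda>y. Gl (H (s k) y)) (ball b r) \<and>
        (\<forall>y\<in>ball b r. H (s k) y \<in> D \<and> norm (Gl (H (s k) y)) \<le> ME)"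
    proof eventually_elim
      case (elim k)
      hence "H (s k) ` ball b r \<subseteq> D" by blast
      with elim show ?case using holomorphic_map_on_compose[OF _ Gl] GlE ME by blast
    qed
    ultimately show ?thesis by blast
  qed
  obtain s3 e where s3: "strict_mono s3" and e: "holomorphic_map_on e E"
    and lime: "\<And>b. b \<in> E \<Longrightarrow> \<exists>r>0. uniform_limit (ball b r) (\<lambda>k y. Gl (H (s (s3 k)) y)) e sequentially"
  proof (rule Montel_several_variables[of E "\<lambda>k y. Gl (H (s k) y)" ME])
    show "\<exists>r>0. \<forall>\<^sub>F k in sequentially. holomorphic_map_on (\<lambda>y. Gl (H (s k) y)) (ball b r) \<and>
        (\<forall>y\<in>ball b r. norm (Gl (H (s k) y)) \<le> ME)" if "b \<in> E" for b
      using evE[OF that] by (auto elim!: eventually_mono ex_forward)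
  qed (rule that)
  \<comment> \<open>Near \<open>w0\<close> the limit \<open>Hl\<close> takes values in \<open>D\<close>, so there \<open>e = Gl \<circ> Hl\<close> is the identity.\<close>
  have near: "\<forall>\<^sub>F y in nhds w0. e y = y"
  proof -
    have Hw0: "Hl w0 = p" using HG[OF p] Glp by simp
    have "(Hl \<longlongrightarrow> Hl w0) (nhds w0)"
      using holomorphic_map_on_isCont[OF Hl w0]
      unfolding isCont_def by (simp only: tendsto_at_iff_tendsto_nhds)
    from topological_tendstoD[OF this D(1)] have "\<forall>\<^sub>F y in nhds w0. Hl y \<in> D" using p Hw0 by simp
    with eventually_nhds_in_open[OF E(1) w0] show ?thesis
    proof eventually_elim
      case (elim y)
      obtain r where r: "r > 0" "uniform_limit (ball y r) (\<lambda>k y. Gl (H (s (s3 k)) y)) e sequentially"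
        using lime elim(1) by blast
      have "(\<lambda>k. Gl (H (s (s3 k)) y)) \<longlonglongrightarrow> e y"
        using tendsto_uniform_limitI[OF r(2), of y] r(1) by simp
      moreover have "(\<lambda>k. Gl (H (s (s3 k)) y)) \<longlonglongrightarrow> Gl (Hl y)"
        using LIMSEQ_subseq_LIMSEQ[OF isCont_tendsto_compose[OF
            holomorphic_map_on_isCont[OF Gl elim(2)] movH[OF elim(1) tendsto_const]] s3]
        by (simp add: o_def)
      ultimately have "e y = Gl (Hl y)" by (rule LIMSEQ_unique)
      thus ?case using GH elim by simp
    qed
  qed
  have eid: "e y = y" if "y \<in> E" for y
  proof -
    have "e y $ i = y $ i" for i
    proof (rule holomorphic_identity_convex[OF _ _ E(1,2) w0 _ that])
      show "holomorphic_fun_on (\<lambda>y. e y $ i) E" using e by (simp add: holomorphic_map_on_def)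
      have "((\<lambda>y. y $ i) has_derivative (\<lambda>y. y $ i)) (at y)" for y :: "complex ^ 'm"
        by (rule bounded_linear_imp_has_derivative[OF bounded_linear_vec_nth])
      thus "holomorphic_fun_on (\<lambda>y. y $ i) E"
        unfolding holomorphic_fun_on_iff by (intro ballI exI[of _ "\<lambda>y. y $ i"]) simp
      show "\<forall>\<^sub>F y in nhds w0. e y $ i = y $ i" using near by eventually_elim simp
    qed
    thus ?thesis by (simp add: vec_eq_iff)
  qed
  have surj: "w \<in> Gl ` D" if w: "w \<in> E" for w
  proof -
    obtain r1 where r1: "r1 > 0" "uniform_limit (ball w r1) (\<lambda>k y. Gl (H (s (s3 k)) y)) e sequentially"
      using lime[OF w] by blast
    obtain r2 where r2: "r2 > 0" and ev2: "\<forall>\<^sub>F k in sequentially.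
        holomorphic_map_on (\<lambda>y. Gl (H (s k) y)) (ball w r2) \<and>
        (\<forall>y\<in>ball w r2. H (s k) y \<in> D \<and> norm (Gl (H (s k) y)) \<le> ME)" using evE[OF w] by blast
    obtain r3 where r3: "r3 > 0" "ball w r3 \<subseteq> E" using E(1) w by (meson openE)
    define r where "r = min r1 (min r2 r3) / 2"
    have r: "r > 0" "cball w r \<subseteq> ball w r1" "cball w r \<subseteq> ball w r2" "cball w r \<subseteq> E"
      using r1(1) r2 r3 by (auto simp: r_def)
    have "\<forall>\<^sub>F k in sequentially. w \<in> Gl ` D"
      using uniform_limitD[OF r1(2) r(1)] eventually_subseq[OF s3 ev2]
    proof eventually_elim
      case (elim k)
      have "w \<in> (\<lambda>y. Gl (H (s (s3 k)) y)) ` cball w r"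
      proof (rule mem_image_if_uniformly_near_identity[OF r(1)])
        show "continuous_on (cball w r) (\<lambda>y. Gl (H (s (s3 k)) y))"
          using elim(2) r(3) by (meson holomorphic_map_on_imp_continuous_on continuous_on_subset)
        show "dist (Gl (H (s (s3 k)) y)) y \<le> r" if "y \<in> cball w r" for y
          using elim(1) that r(2,4) eid[of y] by (metis less_imp_le subsetD)
      qed
      thus ?case using elim(2) r(3) by blast
    qed
    thus ?thesis by simp
  qed
  have bij: "bij_betw Gl D E"
    unfolding bij_betw_def using surj GlE HG by (metis image_subsetI inj_on_inverseI subsetI subset_antisym)
  have inv: "Hl y = inv_into D Gl y" if y: "y \<in> E" for y
  proof -
    obtain x where "x \<in> D" "y = Gl x" using surj[OF y] by blast
    thus ?thesis using HG bij by (simp add: bij_betw_def inv_into_f_f)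
  qed
  have "holomorphic_map_on (inv_into D Gl) E" by (rule holomorphic_map_on_cong[OF E(1) Hl inv])
  with bij Gl show ?thesis by (auto simp: biholomorphic_def biholomorphism_def)
qed

section \<open>Orbits accumulating at a corner\<close>

text \<open>
  A limit of the \<open>\<phi> k\<close> takes the value \<open>z0\<close> at \<open>p\<close>, so it is constant, and the locally uniform
  convergence to \<open>z0\<close> carries a neighbourhood of each point of \<open>D\<close> into \<open>V\<close>.
\<close>

lemma orbit_subsequence_tends_to_torus_point:
  fixes D :: "(complex ^ 'n) set" and F :: "complex ^ 'n \<Rightarrow> complex ^ 'm"
    and \<phi> :: "nat \<Rightarrow> complex ^ 'n \<Rightarrow> complex ^ 'n"
  assumes D: "open D" "connected D" "bounded D"
    and \<phi>: "\<And>k. holomorphic_map_on (\<phi> k) D" "\<And>k. \<phi> k ` D \<subseteq> D"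
    and p: "p \<in> D" and lim: "(\<lambda>k. \<phi> k p) \<longlonglongrightarrow> z0"
    and V: "open V" "z0 \<in> V" and F: "holomorphic_map_on F V" "inj_on F V"
    and one: "\<And>i. norm (F z0 $ i) = 1" and le: "\<And>z i. z \<in> V \<inter> D \<Longrightarrow> norm (F z $ i) \<le> 1"
  obtains s where "strict_mono (s :: nat \<Rightarrow> nat)"
    "\<And>a. a \<in> D \<Longrightarrow> \<exists>r>0. \<forall>\<^sub>F k in sequentially. \<phi> (s k) ` ball a r \<subseteq> V"
proof -
  obtain M where M: "\<And>x. x \<in> D \<Longrightarrow> norm x \<le> M" using D(3) by (auto simp: bounded_iff)
  obtain s \<Phi> where s: "strict_mono s" and \<Phi>: "holomorphic_map_on \<Phi> D"
    and ul: "\<And>a. a \<in> D \<Longrightarrow> \<exists>r>0. uniform_limit (ball a r) (\<lambda>k. \<phi> (s k)) \<Phi> sequentially"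
  proof (rule Montel_several_variables[of D \<phi> M])
    fix a assume "a \<in> D"
    then obtain r where r: "r > 0" "ball a r \<subseteq> D" using D(1) by (meson openE)
    have "holomorphic_map_on (\<phi> k) (ball a r) \<and> (\<forall>x\<in>ball a r. norm (\<phi> k x) \<le> M)" for k
      using holomorphic_map_on_subset[OF \<phi>(1) r(2)] M \<phi>(2) r(2) by blast
    thus "\<exists>r>0. \<forall>\<^sub>F k in sequentially. holomorphic_map_on (\<phi> k) (ball a r) \<and>
        (\<forall>x\<in>ball a r. norm (\<phi> k x) \<le> M)" using r(1) by (intro exI[of _ r]) simp
  qed (rule that)
  have pt: "(\<lambda>k. \<phi> (s k) x) \<longlonglongrightarrow> \<Phi> x" if x: "x \<in> D" for x
  proof -
    obtain r where r: "r > 0" "uniform_limit (ball x r) (\<lambda>k. \<phi> (s k)) \<Phi> sequentially"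
      using ul[OF x] by blast
    show ?thesis using tendsto_uniform_limitI[OF r(2), of x] r(1) by simp
  qed
  have "\<Phi> p = z0"
    using LIMSEQ_unique[OF pt[OF p]] LIMSEQ_subseq_LIMSEQ[OF lim s] by (simp add: o_def)
  have const: "\<Phi> x = z0" if "x \<in> D" for x
  proof (rule constant_if_touching_unimodular_point[OF D(1,2) \<Phi> p \<open>\<Phi> p = z0\<close> V F one _ that])
    fix x i assume x: "x \<in> D" "\<Phi> x \<in> V"
    have "(\<lambda>k. F (\<phi> (s k) x)) \<longlonglongrightarrow> F (\<Phi> x)"
      by (rule isCont_tendsto_compose[OF holomorphic_map_on_isCont[OF F(1) x(2)] pt[OF x(1)]])
    hence "(\<lambda>k. norm (F (\<phi> (s k) x) $ i)) \<longlonglongrightarrow> norm (F (\<Phi> x) $ i)"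
      by (intro tendsto_norm tendsto_vec_nth)
    moreover have "\<forall>\<^sub>F k in sequentially. norm (F (\<phi> (s k) x) $ i) \<le> 1"
      using topological_tendstoD[OF pt[OF x(1)] V(1) x(2)]
      by eventually_elim (use le \<phi>(2) x(1) in blast)
    ultimately show "norm (F (\<Phi> x) $ i) \<le> 1"
      using tendsto_upperbound sequentially_bot by blast
  qed
  obtain \<epsilon> where \<epsilon>: "\<epsilon> > 0" "ball z0 \<epsilon> \<subseteq> V" using V by (meson openE)
  have "\<exists>r>0. \<forall>\<^sub>F k in sequentially. \<phi> (s k) ` ball a r \<subseteq> V" if a: "a \<in> D" for a
  proof -
    obtain r where r: "r > 0" "uniform_limit (ball a r) (\<lambda>k. \<phi> (s k)) \<Phi> sequentially"
      using ul[OF a] by blast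
    obtain r' where r': "r' > 0" "ball a r' \<subseteq> D" using D(1) a by (meson openE)
    have "\<forall>\<^sub>F k in sequentially. \<phi> (s k) ` ball a (min r r') \<subseteq> V"
      using uniform_limitD[OF r(2) \<epsilon>(1)]
    proof eventually_elim
      case (elim k)
      have "\<phi> (s k) x \<in> ball z0 \<epsilon>" if "x \<in> ball a (min r r')" for x
      proof -
        have "x \<in> D" using that r'(2) by auto
        moreover have "dist (\<phi> (s k) x) (\<Phi> x) < \<epsilon>" using elim that by simp
        ultimately show ?thesis by (simp add: const dist_commute)
      qed
      thus ?case using \<epsilon>(2) by blast
    qed
    thus ?thesis using r(1) r'(1) by (intro exI[of _ "min r r'"]) simp
  qed
  with s show thesis by (rule that)
qed

theorem theorem8p2:
  fixes D U :: "(complex ^ 'n) set"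
    and z0 :: "complex ^ 'n"
    and f :: "'n \<Rightarrow> complex ^ 'n \<Rightarrow> complex"
  assumes "domain_Cn D" and "bounded D"
    and "z0 \<in> frontier D"
    and "open U" and "z0 \<in> U"
    and "\<And>i. holomorphic_fun_on (f i) U"
    and "U \<inter> D = {z \<in> U. \<forall>i. norm (f i z) < 1}"
    and "\<And>i. norm (f i z0) = 1"
    and "wedge_differentials f z0 \<noteq> (\<lambda>v. 0)"
    and "orbit_accumulation_point D z0"
  shows "biholomorphic D (unit_polydisc :: (complex ^ 'n) set)"
proof -
  have D: "open D" "connected D" using assms(1) by (auto simp: domain_Cn_def)
  define F where "F z = (\<chi> i. f i z)" for z
  have holF: "holomorphic_map_on F U" using assms(6) by (simp add: holomorphic_map_on_def F_def)
  obtain F0 where F0: "(F has_derivative F0) (at z0)" "\<And>c h. F0 (c *s h) = c *s F0 h"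
    using holF assms(5) unfolding holomorphic_map_on_iff by blast
  have "frechet_derivative (f i) (at z0) = (\<lambda>h. F0 h $ i)" for i
    using F0(1) unfolding has_derivative_vec_iff by (simp add: F_def frechet_derivative_at[symmetric])
  hence "wedge_forms (\<lambda>i h. F0 h $ i) \<noteq> (\<lambda>v. 0)"
    using assms(9) by (simp add: wedge_differentials_def)
  hence "inj F0" by (rule inj_of_wedge_forms_nonzero[OF has_derivative_linear[OF F0(1)] F0(2)])
  then obtain V W g where V: "open V" "V \<subseteq> U" "z0 \<in> V" and W: "open W" "F z0 \<in> W"
    and hom: "homeomorphism V W F g" and holg: "holomorphic_map_on g W"
    using holomorphic_inverse_function_theorem[OF assms(4) holF assms(5) F0(1)] by metis
  have gF: "g (F z) = z" "F z \<in> W" if "z \<in> V" for z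
    using hom that by (auto simp: homeomorphism_def)
  have Fg: "F (g y) = y" "g y \<in> V" if "y \<in> W" for y
    using hom that by (auto simp: homeomorphism_def)
  have DV: "z \<in> D \<longleftrightarrow> F z \<in> unit_polydisc" if "z \<in> V" for z
    using assms(7) that V(2) by (auto simp: unit_polydisc_def F_def)
  have holFV: "holomorphic_map_on F V" using holomorphic_map_on_subset[OF holF V(2)] .
  have one: "norm (F z0 $ i) = 1" for i using assms(8) by (simp add: F_def)

  obtain p \<Phi> where p: "p \<in> D" and \<Phi>: "\<And>k::nat. \<Phi> k \<in> Aut D" and lim: "(\<lambda>k. \<Phi> k p) \<longlonglongrightarrow> z0"
    using assms(10) by (auto simp: orbit_accumulation_point_def)
  have bij: "bij_betw (\<Phi> k) D D" and hol\<Phi>: "holomorphic_map_on (\<Phi> k) D"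
    and holi: "holomorphic_map_on (inv_into D (\<Phi> k)) D" for k
    using \<Phi>[of k] by (auto simp: Aut_def biholomorphism_def)
  have \<Phi>D: "\<Phi> k ` D \<subseteq> D" for k using bij[of k] by (simp add: bij_betw_def)
  obtain s where s: "strict_mono s"
    and toV: "\<And>a. a \<in> D \<Longrightarrow> \<exists>r>0. \<forall>\<^sub>F k in sequentially. \<Phi> (s k) ` ball a r \<subseteq> V"
  proof (rule orbit_subsequence_tends_to_torus_point[OF D assms(2) hol\<Phi> \<Phi>D p lim V(1,3) holFV _ one])
    show "inj_on F V" using gF(1) by (rule inj_on_inverseI)
    show "norm (F z $ i) \<le> 1" if "z \<in> V \<inter> D" for z i
      using DV that by (auto simp: unit_polydisc_def less_imp_le)
  qed (rule that)
  define \<psi> where "\<psi> k = \<Phi> (s k)" for k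
  \<comment> \<open>The points \<open>q k\<close> tend to the torus; the Moebius maps that move them to the origin blow up the
    corner \<open>V \<inter> D\<close> to the whole polydisc.\<close>
  define q where "q k = F (\<psi> k p)" for k
  define G where "G k z = polydisc_moebius (q k) (F (\<psi> k z))" for k z
  define H where "H k w = inv_into D (\<psi> k) (g (polydisc_moebius (- q k) w))" for k w
  have inv\<psi>: "inv_into D (\<psi> k) (\<psi> k x) = x" "\<psi> k x \<in> D" if "x \<in> D" for k x
    using bij[of "s k"] that by (auto simp: \<psi>_def bij_betw_def inv_into_f_f)
  have \<psi>inv: "\<psi> k (inv_into D (\<psi> k) x) = x" "inv_into D (\<psi> k) x \<in> D" if "x \<in> D" for k x
    using bij[of "s k"] that
    by (auto simp: \<psi>_def bij_betw_inv_into_right intro: bij_betwE[OF bij_betw_inv_into, rule_format])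
  have limp: "(\<lambda>k. \<psi> k p) \<longlonglongrightarrow> z0" using LIMSEQ_subseq_LIMSEQ[OF lim s] by (simp add: \<psi>_def o_def)
  have limq: "q \<longlonglongrightarrow> F z0"
    unfolding q_def by (rule isCont_tendsto_compose[OF holomorphic_map_on_isCont[OF holFV V(3)] limp])
  have evq: "\<forall>\<^sub>F k in sequentially. q k \<in> unit_polydisc"
    using topological_tendstoD[OF limp V(1,3)] by eventually_elim (use DV inv\<psi>(2)[OF p] in \<open>auto simp: q_def\<close>)

  show ?thesis
  proof (rule biholomorphic_of_local_inverse_pairs[of D unit_polydisc G H p 0])
    fix a assume a: "a \<in> D"
    \<comment> \<open>\<open>G k\<close> is defined near \<open>a\<close> once \<open>\<psi> k\<close> has carried a neighbourhood of \<open>a\<close> into \<open>V\<close>.\<close>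
    obtain r1 where r1: "r1 > 0" and ev: "\<forall>\<^sub>F k in sequentially. \<psi> k ` ball a r1 \<subseteq> V"
      using toV[OF a] unfolding \<psi>_def by blast
    obtain r2 where r2: "r2 > 0" "ball a r2 \<subseteq> D" using D(1) a by (meson openE)
    define B where "B = ball a (min r1 r2)"
    have B: "B \<subseteq> ball a r1" "B \<subseteq> D" using r2(2) by (auto simp: B_def)
    have "\<forall>\<^sub>F k in sequentially. holomorphic_map_on (G k) B \<and>
        (\<forall>x\<in>B. G k x \<in> unit_polydisc \<and> H k (G k x) = x)"
      using ev evq
    proof eventually_elim
      case (elim k)
      have in_V: "\<psi> k x \<in> V" "\<psi> k x \<in> D" if "x \<in> B" for x
        using elim(1) B that inv\<psi>(2) by blast+
      hence in_P: "F (\<psi> k x) \<in> unit_polydisc" if "x \<in> B" for x using DV that by blast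
      have "holomorphic_map_on (\<lambda>x. F (\<psi> k x)) B"
        by (rule holomorphic_map_on_compose[OF holomorphic_map_on_subset[OF hol\<Phi>[of "s k", folded \<psi>_def] B(2)] holFV])
           (use in_V in blast)
      hence "holomorphic_map_on (G k) B"
        unfolding G_def
        by (rule holomorphic_map_on_compose[OF _ holomorphic_polydisc_moebius[OF elim(2)]]) (use in_P in blast)
      moreover have "G k x \<in> unit_polydisc \<and> H k (G k x) = x" if x: "x \<in> B" for x
        using polydisc_moebius_mem[OF elim(2) in_P[OF x]] polydisc_moebius_inverse(2)[OF elim(2) in_P[OF x]]
          gF(1)[OF in_V(1)[OF x]] inv\<psi>(1)[of x] x B(2) by (auto simp: G_def H_def)
      ultimately show ?case by blast
    qed
    thus "\<exists>r>0. \<forall>\<^sub>F k in sequentially. holomorphic_map_on (G k) (ball a r) \<and>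
        (\<forall>x\<in>ball a r. G k x \<in> unit_polydisc \<and> H k (G k x) = x)"
      unfolding B_def using r1 r2(1) by (intro exI[of _ "min r1 r2"]) simp
  next
    fix b :: "complex ^ 'n" assume b: "b \<in> unit_polydisc"
    \<comment> \<open>\<open>H k\<close> is defined near \<open>b\<close> once the inverse Moebius map carries a neighbourhood of \<open>b\<close> into \<open>W\<close>.\<close>
    have "\<forall>\<^sub>F x in nhds (F z0) \<times>\<^sub>F nhds b. (case x of (q, y) \<Rightarrow> polydisc_moebius (- q) y) \<in> W"
      using topological_tendstoD[OF polydisc_moebius_tendsto_torus_point[OF one b] W] .
    then obtain P Q where PQ: "eventually P (nhds (F z0))" "eventually Q (nhds b)"
      "\<And>q y. P q \<Longrightarrow> Q y \<Longrightarrow> polydisc_moebius (- q) y \<in> W"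
      unfolding eventually_prod_filter by auto
    obtain r where r: "r > 0" and rQ: "\<And>y. y \<in> ball b r \<Longrightarrow> Q y \<and> y \<in> unit_polydisc"
      using eventually_conj[OF PQ(2) eventually_nhds_in_open[OF open_unit_polydisc b]]
      unfolding eventually_nhds_metric by (auto simp: dist_commute)
    have "\<forall>\<^sub>F k in sequentially. P (q k)" using eventually_compose_filterlim[OF PQ(1) limq] .
    with evq have "\<forall>\<^sub>F k in sequentially. holomorphic_map_on (H k) (ball b r) \<and>
        (\<forall>y\<in>ball b r. H k y \<in> D \<and> G k (H k y) = y)"
    proof eventually_elim
      case (elim k)
      define m where "m = polydisc_moebius (- q k)"
      have mq: "- q k \<in> unit_polydisc" using elim(1) by (simp add: uminus_mem_unit_polydisc)
      have mW: "m y \<in> W" "m y \<in> unit_polydisc" if "y \<in> ball b r" for y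
        using PQ(3)[OF elim(2)] rQ[OF that] polydisc_moebius_mem[OF mq] by (auto simp: m_def)
      have gm: "g (m y) \<in> D" if "y \<in> ball b r" for y
        using DV[OF Fg(2)] Fg(1) mW[OF that] by simp
      have "holomorphic_map_on m (ball b r)"
        unfolding m_def by (rule holomorphic_map_on_subset[OF holomorphic_polydisc_moebius[OF mq]]) (use rQ in blast)
      hence "holomorphic_map_on (\<lambda>y. g (m y)) (ball b r)"
        by (rule holomorphic_map_on_compose[OF _ holg]) (use mW in blast)
      hence "holomorphic_map_on (H k) (ball b r)"
        unfolding H_def m_def[symmetric]
        by (rule holomorphic_map_on_compose[OF _ holi[of "s k", folded \<psi>_def]]) (use gm in blast)
      moreover have "H k y \<in> D \<and> G k (H k y) = y" if y: "y \<in> ball b r" for y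
        using \<psi>inv[OF gm[OF y], of k] Fg(1)[OF mW(1)[OF y]] polydisc_moebius_inverse(1)[OF elim(1)] rQ[OF y]
        by (simp add: G_def H_def m_def)
      ultimately show ?case by blast
    qed
    thus "\<exists>r>0. \<forall>\<^sub>F k in sequentially. holomorphic_map_on (H k) (ball b r) \<and>
        (\<forall>y\<in>ball b r. H k y \<in> D \<and> G k (H k y) = y)" using r by blast
  next
    show "0 \<in> (unit_polydisc :: (complex ^ 'n) set)" by (simp add: unit_polydisc_def)
    show "G k p = 0" for k by (simp add: G_def q_def polydisc_moebius_self)
    show "l ` D \<subseteq> unit_polydisc" if "holomorphic_map_on l D" "l ` D \<subseteq> closure unit_polydisc"
      "l p \<in> unit_polydisc" for l :: "complex ^ 'n \<Rightarrow> complex ^ 'n"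
      using unit_polydisc_taut[OF D that(1,2) p that(3)] .
  qed (use D p assms(2) in \<open>auto simp: open_unit_polydisc convex_unit_polydisc bounded_unit_polydisc\<close>)
qed

end
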